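(* Let $P$ be the transition matrix of an aperiodic, irreducible, reversible Markov chain on an $m$-letter totally ordered alphabet $\mathcal{A}_m=\{\alpha_1<\cdots<\alpha_m\}$, with stationary distribution $(\pi_1,\dots,\pi_m)$, and let $\Pi=\mathrm{diag}(\pi_1,\dots,\pi_m)$. Then the asymptotic covariance matrix $\Sigma$ is given by $$\Sigma=\Pi^{1/2}S^T(I+2D)S\,\Pi^{1/2},$$ where $P=(S\Pi^{1/2})^{-1}\Lambda(S\Pi^{1/2})$ is the diagonalization of $P$, with $S$ a real orthogonal matrix, $\Lambda=\mathrm{diag}(1,\lambda_2,\dots,\lambda_m)$, and $D=\mathrm{diag}\left(-\tfrac12,\tfrac{\lambda_2}{1-\lambda_2},\dots,\tfrac{\lambda_m}{1-\lambda_m}\right)$. If, moreover, $P$ is doubly stochastic, i.e. if $P$ is symmetric, then $\Sigma$ is a rescaled version of the asymptotic covariance matrix $\Sigma_{uiid}$ of the iid uniform case (i.e. $\Sigma=a\Sigma_{uiid}$ for some $a>0$) if and only if $P=\alpha P_{uiid}+(1-\alpha)I$ for some $0<\alpha\le m/(m-1)$, where $P_{uiid}$ is the $m\times m$ transition matrix of the iid uniform case, with all entries $1/m$.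
   Context: Here $m\ge2$. Reversible means $\pi_iP_{i,j}=\pi_jP_{j,i}$ for all $1\le i,j\le m$. The asymptotic covariance matrix of an irreducible aperiodic chain with transition matrix $P$ and stationary distribution $\pi$ is defined as follows: let $P=R^{-1}JR$ be a Jordan decomposition of $P$ where the rows of $R$ are generalized left eigenvectors of $P$, the first row of $R$ is $(\pi_1,\dots,\pi_m)$, and $J=\mathrm{diag}(1,\tilde J)$ with $\tilde J$ an $(m-1)\times(m-1)$ lower Jordan-block matrix. Put $E=\mathrm{diag}(-1/2,\tilde J(I-\tilde J)^{-1})$. Then $\Sigma=\Pi+\Pi(R^{-1}ER)+(R^{-1}ER)^T\Pi$. For $P_{uiid}$ this gives $\Sigma_{uiid}=\frac1m(I-P_{uiid})$. *)

theory Defs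
  imports
    Complex_Main
    "Jordan_Normal_Form.Matrix"
    "Jordan_Normal_Form.Gauss_Jordan_Elimination"
    "Jordan_Normal_Form.Jordan_Normal_Form"
begin

(* States are the ranks 0, ..., m - 1 of the letters in the ordered alphabet, so the mathematical
   index i is i - 1 here; P $$ (i, j) is the probability of a transition from i to j. *)

definition stochastic_mat :: "real mat \<Rightarrow> bool" where
  "stochastic_mat P \<longleftrightarrow> square_mat P \<and>
     (\<forall>i<dim_row P. \<forall>j<dim_row P. 0 \<le> P $$ (i, j)) \<and>
     (\<forall>i<dim_row P. (\<Sum>j<dim_row P. P $$ (i, j)) = 1)"

definition doubly_stochastic_mat :: "real mat \<Rightarrow> bool" where
  "doubly_stochastic_mat P \<longleftrightarrow> stochastic_mat P \<and>
     (\<forall>j<dim_row P. (\<Sum>i<dim_row P. P $$ (i, j)) = 1)"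

definition irreducible_chain :: "real mat \<Rightarrow> bool" where
  "irreducible_chain P \<longleftrightarrow>
     (\<forall>i<dim_row P. \<forall>j<dim_row P. \<exists>n>0. (P ^\<^sub>m n) $$ (i, j) > 0)"

definition aperiodic_chain :: "real mat \<Rightarrow> bool" where
  "aperiodic_chain P \<longleftrightarrow>
     (\<forall>i<dim_row P. Gcd {n::nat. n > 0 \<and> (P ^\<^sub>m n) $$ (i, i) > 0} = 1)"

definition stationary_distribution :: "real mat \<Rightarrow> real vec \<Rightarrow> bool" where
  "stationary_distribution P \<pi> \<longleftrightarrow> dim_vec \<pi> = dim_row P \<and>
     (\<forall>i<dim_vec \<pi>. 0 \<le> \<pi> $ i) \<and> (\<Sum>i<dim_vec \<pi>. \<pi> $ i) = 1 \<and>
     (\<forall>j<dim_row P. (\<Sum>i<dim_row P. \<pi> $ i * P $$ (i, j)) = \<pi> $ j)"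

definition reversible_chain :: "real mat \<Rightarrow> real vec \<Rightarrow> bool" where
  "reversible_chain P \<pi> \<longleftrightarrow>
     (\<forall>i<dim_row P. \<forall>j<dim_row P. \<pi> $ i * P $$ (i, j) = \<pi> $ j * P $$ (j, i))"

definition uiid_mat :: "nat \<Rightarrow> real mat" where
  "uiid_mat m = mat m m (\<lambda>_. 1 / real m)"

definition real_orthogonal_mat :: "real mat \<Rightarrow> bool" where
  "real_orthogonal_mat S \<longleftrightarrow> square_mat S \<and>
     inverts_mat S (transpose_mat S) \<and> inverts_mat (transpose_mat S) S"

(* Meaningful only for invertible A. *)
definition inv_mat :: "'a :: field mat \<Rightarrow> 'a mat" where
  "inv_mat A = the (mat_inverse A)"

definition diag_of_vec :: "'a :: zero vec \<Rightarrow> 'a mat" where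
  "diag_of_vec v = mat_diag (dim_vec v) (\<lambda>i. v $ i)"

(* Entrywise square root, which is the matrix square root of a nonnegative diagonal matrix. *)
definition sqrt_diag :: "real vec \<Rightarrow> real mat" where
  "sqrt_diag v = diag_of_vec (map_vec sqrt v)"

(* diag(a, A) for a scalar a and a square matrix A *)
definition border_diag :: "'a :: zero \<Rightarrow> 'a mat \<Rightarrow> 'a mat" where
  "border_diag a A = diag_block_mat [mat 1 1 (\<lambda>_. a), A]"

(* The library's Jordan blocks carry their ones on the superdiagonal. *)
definition lower_jordan_mat :: "'a :: {zero,one} mat \<Rightarrow> bool" where
  "lower_jordan_mat J \<longleftrightarrow>
     (\<exists>n_as. 0 \<notin> fst ` set n_as \<and> J = transpose_mat (jordan_matrix n_as))"

(* P = R^-1 diag(1, J) R over the complex numbers. Since J is lower triangular, R P = diag(1, J) R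
   makes the rows of R generalized left eigenvectors of P. *)
definition jordan_decomposition :: "real mat \<Rightarrow> real vec \<Rightarrow> complex mat \<Rightarrow> complex mat \<Rightarrow> bool" where
  "jordan_decomposition P \<pi> R J \<longleftrightarrow>
     R \<in> carrier_mat (dim_row P) (dim_row P) \<and> invertible_mat R \<and>
     row R 0 = map_vec complex_of_real \<pi> \<and>
     J \<in> carrier_mat (dim_row P - 1) (dim_row P - 1) \<and> lower_jordan_mat J \<and>
     map_mat complex_of_real P = inv_mat R * border_diag 1 J * R"

definition covariance_of_decomposition :: "real vec \<Rightarrow> complex mat \<Rightarrow> complex mat \<Rightarrow> complex mat" where
  "covariance_of_decomposition \<pi> R J =
     (let Dpi = diag_of_vec (map_vec complex_of_real \<pi>);
          E = border_diag (- 1 / 2) (J * inv_mat (1\<^sub>m (dim_row J) - J));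
          M = inv_mat R * E * R
      in Dpi + Dpi * M + transpose_mat M * Dpi)"

(* The stationary distribution is unique for an irreducible chain, and the value does not depend on
   the decomposition: diag(-1/2, J (I - J)^-1), conjugated by R, is P (I - P + Q)^-1 - (3/2) Q,
   where every row of Q is the stationary distribution. *)
definition asymptotic_covariance :: "real mat \<Rightarrow> real mat" where
  "asymptotic_covariance P =
     (THE \<Sigma>. \<exists>\<pi> R J. stationary_distribution P \<pi> \<and> jordan_decomposition P \<pi> R J \<and>
        map_mat complex_of_real \<Sigma> = covariance_of_decomposition \<pi> R J)"

(* In the next three definitions only the values l i with 0 < i < m matter; l i is the
   eigenvalue lambda_(i+1), and lambda_1 = 1. *)
definition Lambda_mat :: "nat \<Rightarrow> (nat \<Rightarrow> real) \<Rightarrow> real mat" where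
  "Lambda_mat m l = mat_diag m (\<lambda>i. if i = 0 then 1 else l i)"

definition D_mat :: "nat \<Rightarrow> (nat \<Rightarrow> real) \<Rightarrow> real mat" where
  "D_mat m l = mat_diag m (\<lambda>i. if i = 0 then - 1 / 2 else l i / (1 - l i))"

definition orthogonal_diagonalization ::
    "real mat \<Rightarrow> real vec \<Rightarrow> real mat \<Rightarrow> (nat \<Rightarrow> real) \<Rightarrow> bool" where
  "orthogonal_diagonalization P \<pi> S l \<longleftrightarrow>
     S \<in> carrier_mat (dim_row P) (dim_row P) \<and> real_orthogonal_mat S \<and>
     P = inv_mat (S * sqrt_diag \<pi>) * Lambda_mat (dim_row P) l * (S * sqrt_diag \<pi>)"

end

theory Submission
  imports Defs "Jordan_Normal_Form.Spectral_Radius"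
begin

text \<open>
  The eigenvalue 1 of an irreducible chain is simple, with constant right and \<open>\<pi>\<close>-proportional left
  eigenvectors. Hence \<open>R\<^sup>-\<^sup>1 diag(1, 0) R\<close> is the matrix \<open>Q\<close> with all rows \<open>\<pi>\<close>, whatever the
  decomposition, and \<open>R\<^sup>-\<^sup>1 E R = (P - (3/2) Q) (I - P + Q)\<^sup>-\<^sup>1\<close> does not depend on it either. Reversibility
  makes \<open>\<Pi>\<^sup>1\<^sup>/\<^sup>2 P \<Pi>\<^sup>-\<^sup>1\<^sup>/\<^sup>2\<close> symmetric, so \<open>R = S \<Pi>\<^sup>1\<^sup>/\<^sup>2\<close> with orthogonal \<open>S\<close> may be used to evaluate \<open>\<Sigma>\<close>. In the
  doubly stochastic case \<open>P\<close> and the uniform matrix are diagonal in the same basis, and \<open>\<Sigma> = a \<Sigma>\<^sub>u\<^sub>i\<^sub>i\<^sub>d\<close> says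
  \<open>(1 + \<lambda>\<^sub>i) / (1 - \<lambda>\<^sub>i) = a\<close> for all \<open>i \<ge> 2\<close>, i.e. \<open>\<lambda>\<^sub>i = 1 - \<alpha>\<close> with \<open>\<alpha> = 2 / (1 + a)\<close>.
\<close>

subsection \<open>Bordered and diagonal matrices\<close>

text \<open>For square matrices over a field a right inverse is two-sided, so \<open>A\<close> is a
  unit of the matrix ring. This rules out \<open>None\<close>; in the other case associativity
  identifies the computed inverse with \<open>B\<close>.\<close>

lemma inv_mat_eqI:
  fixes A B :: "'a::field mat"
  assumes A: "A \<in> carrier_mat n n" and B: "B \<in> carrier_mat n n" and AB: "A * B = 1\<^sub>m n"
  shows "inv_mat A = B"
proof (cases "mat_inverse A")
  case None
  have "B * A = 1\<^sub>m n" by (rule mat_mult_left_right_inverse[OF A B AB])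
  then have "A \<in> Units (ring_mat TYPE('a) n ())"
    using A B AB by (auto simp: Units_def ring_mat_simps)
  then show ?thesis using mat_inverse(1)[OF A None, of "()"] by simp
next
  case (Some C)
  note C = mat_inverse(2)[OF A Some]
  have "C = C * (A * B)" unfolding AB using C by (metis right_mult_one_mat)
  also have "\<dots> = (C * A) * B" using A B C by (metis assoc_mult_mat)
  also have "\<dots> = B" using B C by simp
  finally show ?thesis by (simp add: inv_mat_def Some)
qed

lemma inv_mat_inverse:
  fixes A :: "'a::field mat"
  assumes A: "A \<in> carrier_mat n n" and inv: "invertible_mat A"
  shows "inv_mat A \<in> carrier_mat n n" "A * inv_mat A = 1\<^sub>m n" "inv_mat A * A = 1\<^sub>m n"
proof -
  obtain B where B: "A * B = 1\<^sub>m n" "B * A = 1\<^sub>m (dim_row B)"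
    using inv A by (auto simp: invertible_mat_def inverts_mat_def)
  have Bc: "B \<in> carrier_mat n n"
    using B A by (metis carrier_matD(2) carrier_matI index_mult_mat(2,3) index_one_mat(2,3))
  have "inv_mat A = B" by (rule inv_mat_eqI[OF A Bc B(1)])
  then show "inv_mat A \<in> carrier_mat n n" "A * inv_mat A = 1\<^sub>m n" "inv_mat A * A = 1\<^sub>m n"
    using B Bc by auto
qed

lemma border_diag_four_block:
  "border_diag a A = four_block_mat (mat 1 1 (\<lambda>_. a)) (0\<^sub>m 1 (dim_col A)) (0\<^sub>m (dim_row A) 1) A"
  by (simp only: border_diag_def diag_block_mat.simps(2)[of _ "[A]"] diag_block_mat_singleton Let_def)
    simp

lemma border_diag_eq:
  assumes "A \<in> carrier_mat n n"
  shows "border_diag a A = mat (Suc n) (Suc n)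
    (\<lambda>(i,j). if i = 0 \<and> j = 0 then a else if i = 0 \<or> j = 0 then 0 else A $$ (i - 1, j - 1))"
  using assms by (intro eq_matI) (auto simp: border_diag_four_block)

lemma border_diag_carrier [simp]:
  "A \<in> carrier_mat n n \<Longrightarrow> border_diag a A \<in> carrier_mat (Suc n) (Suc n)"
  by (simp add: border_diag_eq)

text \<open>This is what lets the leading eigenvalue be handled separately from the block of the
  remaining ones.\<close>

lemma mult_border_diag:
  fixes A B :: "'a::semiring_0 mat"
  assumes A: "A \<in> carrier_mat n n" and B: "B \<in> carrier_mat n n"
  shows "border_diag a A * border_diag b B = border_diag (a * b) (A * B)"
proof -
  have "border_diag a A * border_diag b B =
    four_block_mat (mat 1 1 (\<lambda>_. a) * mat 1 1 (\<lambda>_. b) + 0\<^sub>m 1 n * 0\<^sub>m n 1)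
      (mat 1 1 (\<lambda>_. a) * 0\<^sub>m 1 n + 0\<^sub>m 1 n * B)
      (0\<^sub>m n 1 * mat 1 1 (\<lambda>_. b) + A * 0\<^sub>m n 1) (0\<^sub>m n 1 * 0\<^sub>m 1 n + A * B)"
    unfolding border_diag_four_block using A B
    by (subst mult_four_block_mat[of _ 1 1 _ n _ n _ _ 1 _ n]) auto
  also have "mat 1 1 (\<lambda>_. a) * mat 1 1 (\<lambda>_. b) + 0\<^sub>m 1 n * 0\<^sub>m n 1 = mat 1 1 (\<lambda>_. a * b)"
    by (intro eq_matI) (auto simp: scalar_prod_def)
  also have "mat 1 1 (\<lambda>_. a) * 0\<^sub>m 1 n + 0\<^sub>m 1 n * B = 0\<^sub>m 1 n" using B by simp
  also have "0\<^sub>m n 1 * mat 1 1 (\<lambda>_. b) + A * 0\<^sub>m n 1 = 0\<^sub>m n 1" using A by simp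
  also have "0\<^sub>m n 1 * 0\<^sub>m 1 n + A * B = A * B" using A B by simp
  finally show ?thesis using A B by (simp add: border_diag_four_block)
qed

lemma border_diag_one: "border_diag 1 (1\<^sub>m n) = 1\<^sub>m (Suc n)"
  by (intro eq_matI) (auto simp: border_diag_eq[of _ n])

lemma transpose_border_diag:
  "A \<in> carrier_mat n n \<Longrightarrow> transpose_mat (border_diag a A) = border_diag a (transpose_mat A)"
  by (intro eq_matI) (auto simp: border_diag_eq[of _ n])

lemma border_diag_mat_diag:
  "border_diag a (mat_diag n d) = mat_diag (Suc n) (\<lambda>i. if i = 0 then a else d (i - 1))"
  by (intro eq_matI) (auto simp: border_diag_eq[of _ n] mat_diag_def)

lemma transpose_mult_mult:
  fixes A B C :: "'a::comm_semiring_0 mat"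
  assumes "A \<in> carrier_mat n n" "B \<in> carrier_mat n n" "C \<in> carrier_mat n n"
  shows "transpose_mat (A * B * C) = transpose_mat C * transpose_mat B * transpose_mat A"
  using assms by (simp add: transpose_mult[of _ n n _ n] assoc_mult_mat[of _ n n _ n _ n])

lemma transpose_mat_diag [simp]: "transpose_mat (mat_diag n d) = mat_diag n d"
  by (intro eq_matI) (auto simp: mat_diag_def)

lemma symmetric_mat_index:
  assumes "transpose_mat A = A" "A \<in> carrier_mat n n" "i < n" "j < n"
  shows "A $$ (i, j) = A $$ (j, i)"
  using assms by (metis carrier_matD index_transpose_mat(1))

lemma border_diag_add:
  assumes "A \<in> carrier_mat n n" "B \<in> carrier_mat n n"
  shows "border_diag a A + border_diag b B = border_diag (a + b) (A + (B :: 'a::monoid_add mat))"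
  using assms by (intro eq_matI) (auto simp: border_diag_eq[of _ n])

lemma border_diag_minus:
  assumes "A \<in> carrier_mat n n" "B \<in> carrier_mat n n"
  shows "border_diag a A - border_diag b B = border_diag (a - b) (A - (B :: 'a::group_add mat))"
  using assms by (intro eq_matI) (auto simp: border_diag_eq[of _ n] minus_carrier_mat)

lemma border_diag_smult:
  assumes "A \<in> carrier_mat n n"
  shows "c \<cdot>\<^sub>m border_diag a A = border_diag (c * a) (c \<cdot>\<^sub>m (A :: 'a::semiring_0 mat))"
  using assms by (intro eq_matI) (auto simp: border_diag_eq[of _ n])

lemma border_diag_inject:
  assumes "A \<in> carrier_mat n n" "B \<in> carrier_mat n n"
  shows "border_diag a A = border_diag b B \<longleftrightarrow> a = b \<and> A = B"
proof
  assume eq: "border_diag a A = border_diag b B"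
  have "a = b"
    using arg_cong[OF eq, of "\<lambda>M. M $$ (0, 0)"] assms by (simp add: border_diag_eq[of _ n])
  moreover have "A = B"
  proof (rule eq_matI)
    fix i j assume "i < dim_row B" "j < dim_col B"
    then show "A $$ (i, j) = B $$ (i, j)"
      using arg_cong[OF eq, of "\<lambda>M. M $$ (Suc i, Suc j)"] assms
      by (simp add: border_diag_eq[of _ n])
  qed (use assms in auto)
  ultimately show "a = b \<and> A = B" by simp
qed simp

lemma inv_mat_of_det:
  fixes A :: "'a::field mat"
  assumes A: "A \<in> carrier_mat n n" and det: "det A \<noteq> 0"
  shows "inv_mat A \<in> carrier_mat n n" "A * inv_mat A = 1\<^sub>m n"
proof -
  obtain B where "B \<in> carrier_mat n n" "A * B = 1\<^sub>m n"
    using det_non_zero_imp_unit[OF A det, of "()"] by (auto simp: Units_def ring_mat_simps)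
  with inv_mat_eqI[OF A this] show "inv_mat A \<in> carrier_mat n n" "A * inv_mat A = 1\<^sub>m n" by auto
qed

lemma mat_diag_cong: "(\<And>i. i < n \<Longrightarrow> f i = g i) \<Longrightarrow> mat_diag n f = mat_diag n g"
  by (intro eq_matI) (auto simp: mat_diag_def)

lemma mat_diag_inject: "mat_diag n f = mat_diag n g \<longleftrightarrow> (\<forall>i<n. f i = g i)"
proof
  assume eq: "mat_diag n f = mat_diag n g"
  show "\<forall>i<n. f i = g i"
  proof (intro allI impI)
    fix i assume "i < n"
    then show "f i = g i"
      using arg_cong[OF eq, of "\<lambda>M. M $$ (i, i)"] by (simp add: mat_diag_def)
  qed
qed (auto intro: mat_diag_cong)

lemma map_mat_diag: "f 0 = 0 \<Longrightarrow> map_mat f (mat_diag n d) = mat_diag n (\<lambda>i. f (d i))"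
  by (intro eq_matI) (auto simp: mat_diag_def)

text \<open>All Jordan blocks are taken of size 1; the orientation of the blocks is then immaterial,
  since a diagonal matrix is its own transpose.\<close>

lemma lower_jordan_mat_diag: "lower_jordan_mat (mat_diag n d)"
proof -
  have "jordan_matrix (map (\<lambda>i. (1, d i)) [0..<n]) = mat_diag n d" for d :: "nat \<Rightarrow> 'a"
  proof (induction n arbitrary: d)
    case 0
    show ?case by (intro eq_matI) (auto simp: jordan_matrix_def mat_diag_def)
  next
    case (Suc n)
    have "jordan_matrix ((1, d 0) # xs) = border_diag (d 0) (jordan_matrix xs)" for xs
    proof -
      have "jordan_block 1 (d 0) = mat 1 1 (\<lambda>_. d 0)"
        by (intro eq_matI) (auto simp: jordan_block_def)
      then show ?thesis
        by (simp add: jordan_matrix_def border_diag_four_block Let_def)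
    qed
    moreover have "map (\<lambda>i. (1::nat, d i)) [0..<Suc n] =
        (1, d 0) # map (\<lambda>i. (1, d (Suc i))) [0..<n]"
      by (simp add: upt_conv_Cons map_Suc_upt[symmetric] del: upt_Suc)
    ultimately have "jordan_matrix (map (\<lambda>i. (1, d i)) [0..<Suc n]) =
        border_diag (d 0) (mat_diag n (\<lambda>i. d (Suc i)))"
      by (simp only: Suc.IH)
    also have "\<dots> = mat_diag (Suc n) d"
      unfolding border_diag_mat_diag by (rule mat_diag_cong) simp
    finally show ?case .
  qed
  then have "mat_diag n d = transpose_mat (jordan_matrix (map (\<lambda>i. (1, d i)) [0..<n]))"
    by simp
  then show ?thesis
    unfolding lower_jordan_mat_def by (intro exI[of _ "map (\<lambda>i. (1, d i)) [0..<n]"]) auto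
qed

text \<open>The block counts its rows from 0, whence the shift to \<open>l (Suc i)\<close>.\<close>

lemma Lambda_mat_border: "Lambda_mat (Suc k) l = border_diag 1 (mat_diag k (\<lambda>i. l (Suc i)))"
  unfolding border_diag_mat_diag Lambda_mat_def by (rule mat_diag_cong) simp

lemma D_mat_border:
  "D_mat (Suc k) l = border_diag (- 1 / 2) (mat_diag k (\<lambda>i. l (Suc i) / (1 - l (Suc i))))"
  unfolding border_diag_mat_diag D_mat_def by (rule mat_diag_cong) simp

lemma map_border_diag:
  "A \<in> carrier_mat n n \<Longrightarrow> f 0 = 0 \<Longrightarrow> map_mat f (border_diag a A) = border_diag (f a) (map_mat f A)"
  by (intro eq_matI) (auto simp: border_diag_eq[of _ n])

lemma Lambda_mat_carrier [simp]: "Lambda_mat n l \<in> carrier_mat n n"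
  by (simp add: Lambda_mat_def)

lemma D_mat_carrier [simp]: "D_mat n l \<in> carrier_mat n n"
  by (simp add: D_mat_def)

lemma map_of_real_mult3:
  assumes "A \<in> carrier_mat n n" "B \<in> carrier_mat n n" "C \<in> carrier_mat n n"
  shows "map_mat complex_of_real (A * B * C) =
    map_mat of_real A * map_mat of_real B * map_mat of_real C"
  using assms by (simp add: of_real_hom.mat_hom_mult[of _ n n _ n])

lemma map_of_real_add:
  assumes "A \<in> carrier_mat n n" "B \<in> carrier_mat n n"
  shows "map_mat complex_of_real (A + B) = map_mat of_real A + map_mat of_real B"
  using assms by (intro eq_matI) auto

lemma uiid_mat_index [simp]:
  "i < n \<Longrightarrow> j < n \<Longrightarrow> uiid_mat n $$ (i, j) = 1 / real n"
  "dim_row (uiid_mat n) = n" "dim_col (uiid_mat n) = n"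
  by (simp_all add: uiid_mat_def)

lemma uiid_mat_carrier [simp]: "uiid_mat n \<in> carrier_mat n n"
  by (simp add: uiid_mat_def)

text \<open>For the two-letter flip chain, which can return only at even times.\<close>

lemma involution_pow_mat:
  assumes P: "P \<in> carrier_mat n n" and "P * P = 1\<^sub>m n"
  shows "P ^\<^sub>m j = (if even j then 1\<^sub>m n else P)"
  by (induction j) (use assms in auto)

section \<open>Similarity by a fixed invertible matrix\<close>

locale conjugation =
  fixes n :: nat and R R' :: "'a::field mat"
  assumes R: "R \<in> carrier_mat n n" and R': "R' \<in> carrier_mat n n"
    and RR': "R * R' = 1\<^sub>m n" and R'R: "R' * R = 1\<^sub>m n"
begin

text \<open>An injective algebra homomorphism, as the following lemmas show: identities between
  simultaneously conjugated matrices reduce to identities between bordered or diagonal ones.\<close>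

definition conj_mat :: "'a mat \<Rightarrow> 'a mat" where
  "conj_mat X = R' * X * R"

lemmas assoc_n = assoc_mult_mat[of _ n n _ n _ n]

lemma conj_mat_carrier [simp]: "X \<in> carrier_mat n n \<Longrightarrow> conj_mat X \<in> carrier_mat n n"
  using R R' by (simp add: conj_mat_def)

lemma conj_mat_one: "conj_mat (1\<^sub>m n) = 1\<^sub>m n"
  using R R' by (simp add: conj_mat_def R'R)

lemma conj_mat_mult:
  assumes "X \<in> carrier_mat n n" "Y \<in> carrier_mat n n"
  shows "conj_mat X * conj_mat Y = conj_mat (X * Y)"
proof -
  have "conj_mat X * conj_mat Y = R' * X * (R * R') * Y * R"
    unfolding conj_mat_def using assms R R' by (simp add: assoc_n)
  also have "\<dots> = conj_mat (X * Y)"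
    unfolding conj_mat_def RR' using assms R R' by (simp add: assoc_n)
  finally show ?thesis .
qed

lemma conj_mat_add:
  assumes "X \<in> carrier_mat n n" "Y \<in> carrier_mat n n"
  shows "conj_mat (X + Y) = conj_mat X + conj_mat Y"
  unfolding conj_mat_def using assms R R'
  by (simp add: mult_add_distrib_mat[of _ n n] add_mult_distrib_mat[of _ n n])

lemma conj_mat_minus:
  assumes "X \<in> carrier_mat n n" "Y \<in> carrier_mat n n"
  shows "conj_mat (X - Y) = conj_mat X - conj_mat Y"
  unfolding conj_mat_def using assms R R'
  by (simp add: mult_minus_distrib_mat[of _ n n] minus_mult_distrib_mat[of _ n n])

lemma conj_mat_smult:
  assumes "X \<in> carrier_mat n n"
  shows "conj_mat (c \<cdot>\<^sub>m X) = c \<cdot>\<^sub>m conj_mat X"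
  unfolding conj_mat_def using assms R R'
  by (simp add: mult_smult_distrib[of _ n n] mult_smult_assoc_mat[of _ n n])

lemma conj_mat_cancel:
  assumes "X \<in> carrier_mat n n"
  shows "R * conj_mat X * R' = X"
proof -
  have "R * conj_mat X * R' = (R * R') * X * (R * R')"
    unfolding conj_mat_def using assms R R' by (simp add: assoc_n)
  then show ?thesis using assms by (simp add: RR')
qed

lemma conj_mat_inject:
  assumes "X \<in> carrier_mat n n" "Y \<in> carrier_mat n n"
  shows "conj_mat X = conj_mat Y \<longleftrightarrow> X = Y"
  using conj_mat_cancel assms by metis

end

subsection \<open>The spectral theorem for real symmetric matrices\<close>

text \<open>The Householder reflection \<open>I - c w w^T\<close> with \<open>w = v - e_0\<close>
  swaps \<open>v\<close> and the first unit vector \<open>e_0\<close>. Since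
  \<open>w . w = 2 (1 - v_0)\<close>, the factor \<open>c\<close> is the usual
  \<open>2 / (w . w)\<close>.\<close>

lemma householder:
  fixes v :: "real vec"
  assumes v: "v \<in> carrier_vec n" and unit: "v \<bullet> v = 1" and n: "0 < n"
  obtains H where "H \<in> carrier_mat n n" "transpose_mat H = H" "H * H = 1\<^sub>m n" "row H 0 = v"
proof -
  define w where "w i = v $ i - (if i = 0 then 1 else 0)" for i
  \<comment> \<open>If \<open>v $ 0 = 1\<close>, then \<open>v\<close> is the first unit vector, \<open>c = 1 / 0 = 0\<close> and \<open>H\<close> is the identity.\<close>
  define c where "c = 1 / (1 - v $ 0)"
  define H where "H = mat n n (\<lambda>(i,j). (if i = j then 1 else 0) - c * w i * w j)"
  have vv: "(\<Sum>i\<in>{0..<n}. v $ i * v $ i) = 1"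
    using unit v by (simp add: scalar_prod_def)
  have ww: "(\<Sum>i\<in>{0..<n}. w i * w i) = 2 * (1 - v $ 0)"
  proof -
    have "(\<Sum>i\<in>{0..<n}. w i * w i) =
      (\<Sum>i\<in>{0..<n}. v $ i * v $ i + (if i = 0 then 1 - 2 * v $ 0 else 0))"
      by (rule sum.cong) (auto simp: w_def algebra_simps)
    then show ?thesis using n by (simp add: sum.distrib vv)
  qed
  have w0: "w i = 0" if "v $ 0 = 1" "i < n" for i
  proof -
    have "(\<Sum>i\<in>{0..<n}. w i * w i) = 0" using that by (simp add: ww)
    then have "w i * w i = 0"
      using that by (subst (asm) sum_nonneg_eq_0_iff) auto
    then show ?thesis by simp
  qed
  \<comment> \<open>The normalization of \<open>c\<close>, multiplied by \<open>w i\<close> so that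
    it also holds when \<open>v $ 0 = 1\<close> and \<open>w\<close> vanishes.\<close>
  have key: "c * (w i * (1 - v $ 0)) = w i" if "i < n" for i
    using w0[OF _ that] by (cases "v $ 0 = 1") (auto simp: c_def)
  have "H * H = 1\<^sub>m n"
  proof (rule eq_matI)
    fix i j assume ij: "i < dim_row (1\<^sub>m n)" "j < dim_col (1\<^sub>m n)"
    have "(H * H) $$ (i, j) = (\<Sum>k\<in>{0..<n}.
        ((if i = k then 1 else 0) - c * w i * w k) * ((if k = j then 1 else 0) - c * w k * w j))"
      using ij by (simp add: H_def scalar_prod_def)
    also have "\<dots> = (\<Sum>k\<in>{0..<n}. (if i = k then (if k = j then 1 else 0) - c * w k * w j else 0)
        + ((if k = j then - c * w i * w k else 0) + c * w i * c * w j * (w k * w k)))"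
      by (rule sum.cong) (auto simp: algebra_simps)
    also have "\<dots> = (if i = j then 1 else 0) - c * w i * w j +
        (- c * w i * w j + c * w i * c * w j * (\<Sum>k\<in>{0..<n}. w k * w k))"
      using ij by (simp add: sum.distrib sum_distrib_left)
    also have "\<dots> = (if i = j then 1 else 0) - 2 * (c * w j * w i)
        + 2 * (c * w j * (c * (w i * (1 - v $ 0))))"
      by (simp add: ww algebra_simps)
    also have "\<dots> = (1\<^sub>m n) $$ (i, j)" using ij key[of i] by simp
    finally show "(H * H) $$ (i, j) = (1\<^sub>m n) $$ (i, j)" .
  qed (auto simp: H_def)
  moreover have "row H 0 = v"
  proof (rule eq_vecI)
    fix j assume j: "j < dim_vec v"
    have "row H 0 $ j = (if j = 0 then 1 else 0) + c * (w j * (1 - v $ 0))"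
      using j v n by (auto simp: H_def w_def algebra_simps)
    also have "\<dots> = v $ j" using key[of j] j v by (simp only: carrier_vecD) (simp add: w_def)
    finally show "row H 0 $ j = v $ j" .
  qed (use v in \<open>simp add: H_def\<close>)
  moreover have "transpose_mat H = H" by (intro eq_matI) (auto simp: H_def)
  moreover have "H \<in> carrier_mat n n" by (simp add: H_def)
  ultimately show ?thesis by (intro that)
qed

text \<open>Take a complex eigenvector \<open>x + i y\<close> for \<open>\<mu>\<close>. Symmetry
  gives \<open>y . A x = x . A y\<close>, hence \<open>Im \<mu> * (|x|^2 + |y|^2) = 0\<close>. So
  \<open>\<mu>\<close> is real, and whichever of \<open>x\<close>, \<open>y\<close> is nonzero is a
  real eigenvector.\<close>

lemma symmetric_mat_has_eigenvector:
  fixes A :: "real mat"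
  assumes A: "A \<in> carrier_mat n n" and sym: "transpose_mat A = A" and n: "0 < n"
  obtains v a where "v \<in> carrier_vec n" "v \<bullet> v = 1" "A *\<^sub>v v = a \<cdot>\<^sub>v v"
proof -
  let ?C = "map_mat complex_of_real A"
  obtain \<mu> where "eigenvalue ?C \<mu>"
    using spectrum_non_empty[of ?C n] A n by (auto simp: spectrum_def)
  then obtain z where z: "z \<in> carrier_vec n" "z \<noteq> 0\<^sub>v n" "?C *\<^sub>v z = \<mu> \<cdot>\<^sub>v z"
    using A by (auto simp: eigenvalue_def eigenvector_def)
  define x where "x = (\<lambda>i. Re (z $ i))"
  define y where "y = (\<lambda>i. Im (z $ i))"
  have e: "(\<Sum>j\<in>{0..<n}. complex_of_real (A $$ (i, j)) * z $ j) = \<mu> * z $ i" if "i < n" for i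
    using arg_cong[OF z(3), of "\<lambda>u. u $ i"] that A z(1) by (simp add: scalar_prod_def)
  have ex: "(\<Sum>j\<in>{0..<n}. A $$ (i, j) * x j) = Re \<mu> * x i - Im \<mu> * y i" if "i < n" for i
    using arg_cong[OF e[OF that], of Re] by (simp add: x_def y_def)
  have ey: "(\<Sum>j\<in>{0..<n}. A $$ (i, j) * y j) = Re \<mu> * y i + Im \<mu> * x i" if "i < n" for i
    using arg_cong[OF e[OF that], of Im] by (simp add: x_def y_def)
  have "(\<Sum>i\<in>{0..<n}. y i * (\<Sum>j\<in>{0..<n}. A $$ (i, j) * x j)) =
      (\<Sum>i\<in>{0..<n}. x i * (\<Sum>j\<in>{0..<n}. A $$ (i, j) * y j))"
    unfolding sum_distrib_left
    by (subst sum.swap, intro sum.cong)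
      (auto simp: symmetric_mat_index[OF sym A] mult_ac)
  then have "(\<Sum>i\<in>{0..<n}. y i * (Re \<mu> * x i - Im \<mu> * y i)) =
      (\<Sum>i\<in>{0..<n}. x i * (Re \<mu> * y i + Im \<mu> * x i))"
    by (simp add: ex ey)
  then have "Im \<mu> * (\<Sum>i\<in>{0..<n}. x i * x i + y i * y i) = 0"
    by (simp add: algebra_simps sum.distrib sum_subtractf sum_distrib_left)
  moreover obtain i0 where i0: "i0 < n" "z $ i0 \<noteq> 0"
    using z(1,2) by (metis carrier_vecD eq_vecI index_zero_vec(1,2))
  moreover have "(\<Sum>i\<in>{0..<n}. x i * x i + y i * y i) \<noteq> 0"
    using i0 by (subst sum_nonneg_eq_0_iff)
      (auto simp: x_def y_def complex_eq_iff add_nonneg_eq_0_iff)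
  ultimately have im: "Im \<mu> = 0" by simp
  have "\<exists>u i. i < n \<and> u i \<noteq> 0 \<and> (\<forall>i<n. (\<Sum>j\<in>{0..<n}. A $$ (i, j) * u j) = Re \<mu> * u i)"
  proof (cases "x i0 = 0")
    case True
    then have "y i0 \<noteq> 0" using i0 by (auto simp: x_def y_def complex_eq_iff)
    then show ?thesis using i0(1) ey im by (intro exI[of _ y] exI[of _ i0]) simp
  next
    case False
    then show ?thesis using i0(1) ex im by (intro exI[of _ x] exI[of _ i0]) simp
  qed
  then obtain u i where u: "i < n" "u i \<noteq> (0::real)"
    "\<And>i. i < n \<Longrightarrow> (\<Sum>j\<in>{0..<n}. A $$ (i, j) * u j) = Re \<mu> * u i" by blast
  define s where "s = (\<Sum>j\<in>{0..<n}. u j * u j)"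
  have s: "s > 0"
    unfolding s_def using u(1,2) by (intro sum_pos2[of _ i]) (auto simp: zero_less_mult_iff)
  define v where "v = vec n (\<lambda>j. u j / sqrt s)"
  have "v \<bullet> v = (\<Sum>j\<in>{0..<n}. (u j * u j) / s)"
    using s by (auto simp: v_def scalar_prod_def intro!: sum.cong)
  also have "\<dots> = 1" using s by (simp add: s_def flip: sum_divide_distrib)
  finally have "v \<bullet> v = 1" .
  moreover have "A *\<^sub>v v = Re \<mu> \<cdot>\<^sub>v v"
    using A u(3) by (intro eq_vecI) (auto simp: v_def scalar_prod_def simp flip: sum_divide_distrib)
  moreover have "v \<in> carrier_vec n" by (simp add: v_def)
  ultimately show ?thesis by (intro that)
qed

text \<open>The induction step of the spectral theorem, kept separate because the first eigenvector
  can be prescribed: besides the induction, it serves to put the vector of square roots of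
  \<open>\<pi>\<close> into the first row of \<open>S\<close>.\<close>

lemma spectral_deflation:
  fixes A :: "real mat"
  assumes A: "A \<in> carrier_mat (Suc n) (Suc n)" and sym: "transpose_mat A = A"
    and v: "v \<in> carrier_vec (Suc n)" and unit: "v \<bullet> v = 1" and ev: "A *\<^sub>v v = a \<cdot>\<^sub>v v"
    and smaller: "\<And>B. B \<in> carrier_mat n n \<Longrightarrow> transpose_mat B = B \<Longrightarrow>
      \<exists>S d. S \<in> carrier_mat n n \<and> transpose_mat S * S = 1\<^sub>m n \<and>
        B = transpose_mat S * mat_diag n d * (S :: real mat)"
  shows "\<exists>S d. S \<in> carrier_mat (Suc n) (Suc n) \<and> transpose_mat S * S = 1\<^sub>m (Suc n) \<and>
    row S 0 = v \<and> d 0 = a \<and> A = transpose_mat S * mat_diag (Suc n) d * S"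
proof -
  let ?N = "Suc n"
  obtain H where H: "H \<in> carrier_mat ?N ?N" and Ht: "transpose_mat H = H"
    and HH: "H * H = 1\<^sub>m ?N" and Hv: "row H 0 = v"
    using householder[OF v unit] by blast
  note assoc = assoc_mult_mat[of _ ?N ?N _ ?N _ ?N]
  define B where "B = H * A * H"
  have B: "B \<in> carrier_mat ?N ?N" using H A by (simp add: B_def)
  have Bt: "transpose_mat B = B"
    unfolding B_def transpose_mult_mult[OF H A H] Ht sym ..
  have AB: "A = H * B * H"
  proof -
    have "H * B * H = (H * H) * A * (H * H)" unfolding B_def using H A by (simp add: assoc)
    then show ?thesis using A by (simp add: HH)
  qed
  have colH: "col H 0 = v" using row_transpose[of 0 H] Hv Ht H by simp
  \<comment> \<open>\<open>H\<close> maps the first unit vector to \<open>v\<close>, so column 0 of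
    \<open>H * A * H\<close> is \<open>a\<close> times column 0 of \<open>H * H\<close>.\<close>
  have Be0: "B $$ (i, 0) = (if i = 0 then a else 0)" if i: "i < ?N" for i
  proof -
    have "B $$ (i, 0) = row H i \<bullet> (A *\<^sub>v v)"
      using i H A by (simp add: B_def assoc col_mult2[of _ _ ?N] colH mult_mat_vec_def)
    also have "\<dots> = a * (row H i \<bullet> col H 0)"
      unfolding ev colH using v H by (subst scalar_prod_smult_right) auto
    also have "row H i \<bullet> col H 0 = (H * H) $$ (i, 0)" using i H by simp
    also have "\<dots> = (if i = 0 then 1 else 0)" using i by (simp add: HH)
    finally show ?thesis by simp
  qed
  define B' where "B' = mat n n (\<lambda>(i,j). B $$ (Suc i, Suc j))"
  have B': "B' \<in> carrier_mat n n" by (simp add: B'_def)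
  \<comment> \<open>Column 0 is known from \<open>Be0\<close>; symmetry clears row 0 as
    well.\<close>
  have BB': "B = border_diag a B'"
  proof (rule eq_matI)
    fix i j assume "i < dim_row (border_diag a B')" "j < dim_col (border_diag a B')"
    then have ij: "i < ?N" "j < ?N" using B' by (auto simp: border_diag_eq)
    show "B $$ (i, j) = border_diag a B' $$ (i, j)"
      using ij Be0[of i] Be0[of j] symmetric_mat_index[OF Bt B ij]
      by (cases "i = 0"; cases "j = 0") (auto simp: border_diag_eq[OF B'], auto simp: B'_def)
  qed (use B B' in \<open>auto simp: border_diag_eq\<close>)
  have "transpose_mat B' = B'"
    using symmetric_mat_index[OF Bt B] by (intro eq_matI) (auto simp: B'_def)
  then obtain T d where T: "T \<in> carrier_mat n n" "transpose_mat T * T = 1\<^sub>m n"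
    "B' = transpose_mat T * mat_diag n d * T"
    using smaller[OF B'] by blast
  let ?T = "border_diag 1 T"
  define e where "e = (\<lambda>i. if i = 0 then a else d (i - 1))"
  have T1: "?T \<in> carrier_mat ?N ?N" "transpose_mat ?T \<in> carrier_mat ?N ?N"
    using T by (simp_all add: transpose_border_diag)
  have TT: "transpose_mat ?T * ?T = 1\<^sub>m ?N"
    using T by (simp add: transpose_border_diag mult_border_diag[of _ n] border_diag_one)
  have BT: "B = transpose_mat ?T * mat_diag ?N e * ?T"
    using T by (simp add: BB' e_def transpose_border_diag mult_border_diag[of _ n]
        mult_carrier_mat[of _ n n _ n] flip: border_diag_mat_diag)
  define S where "S = ?T * H"
  have S: "S \<in> carrier_mat ?N ?N" using T1 H by (simp add: S_def)
  have St: "transpose_mat S = H * transpose_mat ?T"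
    unfolding S_def using T1 H by (simp add: transpose_mult[of _ ?N ?N _ ?N] Ht)
  have "transpose_mat S * S = H * (transpose_mat ?T * ?T) * H"
    unfolding St unfolding S_def using H T1 by (simp add: assoc)
  then have "transpose_mat S * S = 1\<^sub>m ?N" using H by (simp add: TT HH)
  moreover have "A = transpose_mat S * mat_diag ?N e * S"
    unfolding AB BT St unfolding S_def using H T1
    by (simp add: assoc mult_carrier_mat[of _ ?N ?N _ ?N])
  \<comment> \<open>Row 0 of \<open>?T\<close> is the first unit vector, so it selects row 0 of
    \<open>H\<close>.\<close>
  moreover have "row S 0 = v"
  proof (rule eq_vecI)
    fix j assume "j < dim_vec v"
    then have j: "j < ?N" using v by simp
    have "row S 0 $ j = (\<Sum>k\<in>{0..<?N}. ?T $$ (0, k) * H $$ (k, j))"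
      using j S T1 H by (simp add: S_def scalar_prod_def)
    also have "\<dots> = (\<Sum>k\<in>{0..<?N}. if k = 0 then H $$ (k, j) else 0)"
      using T by (intro sum.cong) (auto simp: border_diag_eq)
    also have "\<dots> = v $ j" using j H by (simp flip: Hv)
    finally show "row S 0 $ j = v $ j" .
  qed (use S v in simp)
  moreover have "e 0 = a" by (simp add: e_def)
  ultimately show ?thesis using S by blast
qed

lemma real_symmetric_spectral:
  fixes A :: "real mat"
  assumes "A \<in> carrier_mat n n" "transpose_mat A = A"
  shows "\<exists>S d. S \<in> carrier_mat n n \<and> transpose_mat S * S = 1\<^sub>m n \<and>
    A = transpose_mat S * mat_diag n d * S"
  using assms
proof (induction n arbitrary: A)
  case 0
  then show ?case by (intro exI[of _ "1\<^sub>m 0"]) (auto intro!: eq_matI)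
next
  case (Suc n)
  obtain v a where "v \<in> carrier_vec (Suc n)" "v \<bullet> v = 1" "A *\<^sub>v v = a \<cdot>\<^sub>v v"
    using symmetric_mat_has_eigenvector[OF Suc.prems] by blast
  from spectral_deflation[OF Suc.prems this Suc.IH] show ?case by blast
qed

subsection \<open>Fixed vectors of a reversible irreducible chain\<close>

text \<open>The size is written \<open>Suc k\<close> so that state 0 exists and the block left after
  splitting off the eigenvalue 1 has size \<open>k\<close>.\<close>

locale reversible_markov =
  fixes k :: nat and P :: "real mat" and \<pi> :: "real vec"
  assumes P: "P \<in> carrier_mat (Suc k) (Suc k)"
    and stoch: "stochastic_mat P"
    and irred: "irreducible_chain P"
    and stat: "stationary_distribution P \<pi>"
    and rev: "reversible_chain P \<pi>"
begin

lemma P_nonneg: "i < Suc k \<Longrightarrow> j < Suc k \<Longrightarrow> 0 \<le> P $$ (i, j)"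
  using stoch P by (auto simp: stochastic_mat_def)

lemma P_row_sum: "i < Suc k \<Longrightarrow> (\<Sum>j<Suc k. P $$ (i, j)) = 1"
  using stoch P unfolding stochastic_mat_def by (metis carrier_matD(1))

lemma pi_dim [simp]: "dim_vec \<pi> = Suc k"
  using stat P by (simp add: stationary_distribution_def)

lemma pi_nonneg: "i < Suc k \<Longrightarrow> 0 \<le> \<pi> $ i"
  using stat pi_dim unfolding stationary_distribution_def by metis

lemma pi_sum: "(\<Sum>i<Suc k. \<pi> $ i) = 1"
  using stat pi_dim unfolding stationary_distribution_def by metis

lemma pi_stationary: "j < Suc k \<Longrightarrow> (\<Sum>i<Suc k. \<pi> $ i * P $$ (i, j)) = \<pi> $ j"
  using stat P unfolding stationary_distribution_def by (metis carrier_matD(1))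

lemma reversible: "i < Suc k \<Longrightarrow> j < Suc k \<Longrightarrow> \<pi> $ i * P $$ (i, j) = \<pi> $ j * P $$ (j, i)"
  using rev P by (auto simp: reversible_chain_def)

lemma irreducible: "i < Suc k \<Longrightarrow> j < Suc k \<Longrightarrow> \<exists>n. (P ^\<^sub>m n) $$ (i, j) > 0"
  using irred P by (auto simp: irreducible_chain_def)

section \<open>Powers of the transition matrix and positivity of the stationary distribution\<close>

lemma pow_index:
  assumes "i < Suc k" "j < Suc k"
  shows "(P ^\<^sub>m Suc n) $$ (i, j) = (\<Sum>l<Suc k. (P ^\<^sub>m n) $$ (i, l) * P $$ (l, j))"
  using assms P pow_carrier_mat[OF P, of n]
  by (simp add: scalar_prod_def lessThan_atLeast0 del: sum.lessThan_Suc)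

lemma pow_nonneg:
  "i < Suc k \<Longrightarrow> j < Suc k \<Longrightarrow> 0 \<le> (P ^\<^sub>m n) $$ (i, j)"
proof (induction n arbitrary: j)
  case (Suc n)
  then show ?case unfolding pow_index[OF Suc.prems]
    by (intro sum_nonneg mult_nonneg_nonneg) (auto intro: P_nonneg)
qed (use P in auto)

lemma pow_right_fixed:
  assumes x: "\<And>i. i < Suc k \<Longrightarrow> (\<Sum>j<Suc k. P $$ (i, j) * x j) = x i" and i: "i < Suc k"
  shows "(\<Sum>j<Suc k. (P ^\<^sub>m n) $$ (i, j) * x j) = x i"
proof (induction n)
  case 0
  have "(\<Sum>j<Suc k. (P ^\<^sub>m 0) $$ (i, j) * x j) = (\<Sum>j<Suc k. if j = i then x j else 0)"
    using P i by (intro sum.cong) auto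
  then show ?case using i by (simp del: sum.lessThan_Suc)
next
  case (Suc n)
  have "(\<Sum>j<Suc k. (P ^\<^sub>m Suc n) $$ (i, j) * x j) =
      (\<Sum>j<Suc k. \<Sum>l<Suc k. (P ^\<^sub>m n) $$ (i, l) * (P $$ (l, j) * x j))"
    using i by (intro sum.cong refl) (simp add: pow_index sum_distrib_right mult.assoc
        del: sum.lessThan_Suc pow_mat.simps)
  also have "\<dots> = (\<Sum>l<Suc k. (P ^\<^sub>m n) $$ (i, l) * (\<Sum>j<Suc k. P $$ (l, j) * x j))"
    by (subst sum.swap) (simp add: sum_distrib_left del: sum.lessThan_Suc)
  also have "\<dots> = (\<Sum>l<Suc k. (P ^\<^sub>m n) $$ (i, l) * x l)"
    by (intro sum.cong refl) (simp add: x del: sum.lessThan_Suc)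
  finally show ?case using Suc by simp
qed

lemma pow_stationary:
  assumes "j < Suc k"
  shows "(\<Sum>i<Suc k. \<pi> $ i * (P ^\<^sub>m n) $$ (i, j)) = \<pi> $ j"
  using assms
proof (induction n arbitrary: j)
  case 0
  have "(\<Sum>i<Suc k. \<pi> $ i * (P ^\<^sub>m 0) $$ (i, j)) = (\<Sum>i<Suc k. if i = j then \<pi> $ i else 0)"
    using P 0 by (intro sum.cong) auto
  then show ?case using 0 by (simp del: sum.lessThan_Suc)
next
  case (Suc n)
  have "(\<Sum>i<Suc k. \<pi> $ i * (P ^\<^sub>m Suc n) $$ (i, j)) =
      (\<Sum>i<Suc k. \<Sum>l<Suc k. \<pi> $ i * (P ^\<^sub>m n) $$ (i, l) * P $$ (l, j))"
    using Suc.prems by (intro sum.cong refl) (simp add: pow_index sum_distrib_left mult.assoc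
        del: sum.lessThan_Suc pow_mat.simps)
  also have "\<dots> = (\<Sum>l<Suc k. (\<Sum>i<Suc k. \<pi> $ i * (P ^\<^sub>m n) $$ (i, l)) * P $$ (l, j))"
    by (subst sum.swap) (simp add: sum_distrib_right del: sum.lessThan_Suc)
  also have "\<dots> = (\<Sum>l<Suc k. \<pi> $ l * P $$ (l, j))"
    by (intro sum.cong refl) (simp add: Suc.IH del: sum.lessThan_Suc)
  finally show ?case using pi_stationary Suc.prems by simp
qed

text \<open>Some state \<open>i\<close> carries mass and reaches \<open>j\<close> in
  \<open>n\<close> steps; stationarity under the \<open>n\<close>-th power then puts positive mass
  on \<open>j\<close>.\<close>

lemma pi_pos:
  assumes j: "j < Suc k"
  shows "0 < \<pi> $ j"
proof -
  obtain i where i: "i < Suc k" "\<pi> $ i \<noteq> 0"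
    using pi_sum by (metis lessThan_iff sum.neutral zero_neq_one)
  obtain n where n: "(P ^\<^sub>m n) $$ (i, j) > 0" using irreducible i(1) j by blast
  have "0 < (\<Sum>i<Suc k. \<pi> $ i * (P ^\<^sub>m n) $$ (i, j))"
    using i n pi_nonneg[OF i(1)] j
    by (intro sum_pos2[of _ i] mult_pos_pos) (auto intro!: mult_nonneg_nonneg pi_nonneg pow_nonneg)
  then show ?thesis using pow_stationary[OF j] by simp
qed

text \<open>Maximum principle: a fixed vector attains its maximum at every state that can be reached
  from a maximal one.\<close>
lemma right_fixed_constant:
  assumes x: "\<And>i. i < Suc k \<Longrightarrow> (\<Sum>j<Suc k. P $$ (i, j) * x j) = x i"
    and j: "j < Suc k"
  shows "x j = x 0"
proof -
  obtain i where i: "i < Suc k" "\<And>j. j < Suc k \<Longrightarrow> x j \<le> x i"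
  proof -
    have "Max (x ` {..<Suc k}) \<in> x ` {..<Suc k}" by (intro Max_in) auto
    then obtain i where "i < Suc k" "x i = Max (x ` {..<Suc k})" by auto
    then show ?thesis by (intro that[of i]) auto
  qed
  have max: "x j = x i" if j: "j < Suc k" for j
  proof -
    obtain n where n: "(P ^\<^sub>m n) $$ (i, j) > 0" using irreducible i(1) j by blast
    have "(\<Sum>l<Suc k. (P ^\<^sub>m n) $$ (i, l) * 1) = 1"
      by (rule pow_right_fixed[of "\<lambda>_. 1"]) (use P_row_sum i in simp_all)
    \<comment> \<open>The gaps below the maximum are nonnegative and average to 0 along row
      \<open>i\<close>, so every gap of positive weight vanishes.\<close>
    then have "(\<Sum>l<Suc k. (P ^\<^sub>m n) $$ (i, l) * (x i - x l)) = 0"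
      using pow_right_fixed[of x i n, OF x i(1)]
      by (simp add: right_diff_distrib sum_subtractf flip: sum_distrib_right del: sum.lessThan_Suc)
    then have "(P ^\<^sub>m n) $$ (i, j) * (x i - x j) = 0"
      using i j by (subst (asm) sum_nonneg_eq_0_iff) (auto intro!: mult_nonneg_nonneg pow_nonneg)
    then show ?thesis using n by simp
  qed
  show ?thesis using max[OF j] max[of 0] by simp
qed

text \<open>As \<open>P\<close> is real, real and imaginary parts are fixed separately. The complex
  version is needed because \<open>R\<close> and \<open>J\<close> are complex.\<close>

lemma right_fixed_constant_complex:
  fixes z :: "nat \<Rightarrow> complex"
  assumes z: "\<And>i. i < Suc k \<Longrightarrow> (\<Sum>j<Suc k. of_real (P $$ (i, j)) * z j) = z i"
    and j: "j < Suc k"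
  shows "z j = z 0"
proof (rule complex_eqI)
  show "Re (z j) = Re (z 0)"
    by (rule right_fixed_constant[of "\<lambda>i. Re (z i)", OF _ j])
      (subst (2) z[symmetric], simp_all del: sum.lessThan_Suc)
  show "Im (z j) = Im (z 0)"
    by (rule right_fixed_constant[of "\<lambda>i. Im (z i)", OF _ j])
      (subst (2) z[symmetric], simp_all del: sum.lessThan_Suc)
qed

text \<open>By detailed balance, dividing a left fixed vector entrywise by \<open>\<pi>\<close>
  gives a right fixed vector, which is constant.\<close>

lemma left_fixed_multiple:
  fixes y :: "nat \<Rightarrow> complex"
  assumes y: "\<And>j. j < Suc k \<Longrightarrow> (\<Sum>i<Suc k. y i * of_real (P $$ (i, j))) = y j"
    and j: "j < Suc k"
  shows "y j = y 0 / of_real (\<pi> $ 0) * of_real (\<pi> $ j)"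
proof -
  have "y j / of_real (\<pi> $ j) = y 0 / of_real (\<pi> $ 0)"
  proof (rule right_fixed_constant_complex[OF _ j])
    fix i assume i: "i < Suc k"
    have "(\<Sum>j<Suc k. of_real (P $$ (i, j)) * (y j / of_real (\<pi> $ j))) =
        (\<Sum>j<Suc k. y j * of_real (P $$ (j, i)) / of_real (\<pi> $ i))"
    proof (rule sum.cong[OF refl])
      fix j assume "j \<in> {..<Suc k}"
      then have j: "j < Suc k" by simp
      have "P $$ (i, j) / \<pi> $ j = P $$ (j, i) / \<pi> $ i"
        using reversible[OF i j] pi_pos[OF i] pi_pos[OF j] by (simp add: field_simps)
      then have "complex_of_real (P $$ (i, j)) / of_real (\<pi> $ j) = of_real (P $$ (j, i)) / of_real (\<pi> $ i)"
        by (metis of_real_divide)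
      then show "of_real (P $$ (i, j)) * (y j / of_real (\<pi> $ j)) =
          y j * of_real (P $$ (j, i)) / of_real (\<pi> $ i)"
        by (metis mult.commute times_divide_eq_right)
    qed
    also have "\<dots> = y i / of_real (\<pi> $ i)"
      using y[OF i] by (simp flip: sum_divide_distrib del: sum.lessThan_Suc)
    finally show "(\<Sum>j<Suc k. of_real (P $$ (i, j)) * (y j / of_real (\<pi> $ j))) =
      y i / of_real (\<pi> $ i)" .
  qed
  then show ?thesis using pi_pos[OF j] by (simp add: field_simps)
qed

subsection \<open>Independence of the decomposition\<close>

abbreviation Pc :: "complex mat" where
  "Pc \<equiv> map_mat complex_of_real P"

text \<open>The spectral projection of \<open>Pc\<close> for the eigenvalue 1, called
  \<open>Q\<close> in the outline.\<close>

definition limit_mat :: "complex mat" where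
  "limit_mat = mat (Suc k) (Suc k) (\<lambda>(i, j). complex_of_real (\<pi> $ j))"

lemma pi_sum_complex: "(\<Sum>i<Suc k. complex_of_real (\<pi> $ i)) = 1"
  using arg_cong[OF pi_sum, of complex_of_real] by (simp only: of_real_sum of_real_1)

lemma fixed_columns_constant:
  assumes X: "X \<in> carrier_mat (Suc k) n" and PX: "Pc * X = X" and i: "i < Suc k" and j: "j < n"
  shows "X $$ (i, j) = X $$ (0, j)"
proof (rule right_fixed_constant_complex[OF _ i])
  fix i assume "i < Suc k"
  then have "(Pc * X) $$ (i, j) = (\<Sum>l<Suc k. of_real (P $$ (i, l)) * X $$ (l, j))"
    using X P j by (simp add: scalar_prod_def lessThan_atLeast0 del: sum.lessThan_Suc)
  then show "(\<Sum>l<Suc k. of_real (P $$ (i, l)) * X $$ (l, j)) = X $$ (i, j)" by (simp add: PX)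
qed

lemma fixed_rows_multiple:
  assumes X: "X \<in> carrier_mat n (Suc k)" and XP: "X * Pc = X" and i: "i < n" and j: "j < Suc k"
  shows "X $$ (i, j) = X $$ (i, 0) / of_real (\<pi> $ 0) * of_real (\<pi> $ j)"
proof (rule left_fixed_multiple[OF _ j])
  fix j assume "j < Suc k"
  then have "(X * Pc) $$ (i, j) = (\<Sum>l<Suc k. X $$ (i, l) * of_real (P $$ (l, j)))"
    using X P i by (simp add: scalar_prod_def lessThan_atLeast0 del: sum.lessThan_Suc)
  then show "(\<Sum>l<Suc k. X $$ (i, l) * of_real (P $$ (l, j))) = X $$ (i, j)" by (simp add: XP)
qed

text \<open>Columns are constant and rows are multiples of \<open>\<pi>\<close>, so
  \<open>E = c * limit_mat\<close>. Idempotence forces \<open>c * c = c\<close>, and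
  \<open>c\<close> is nonzero because \<open>E\<close> is.\<close>

lemma limit_mat_unique:
  assumes E: "E \<in> carrier_mat (Suc k) (Suc k)" and PE: "Pc * E = E" and EP: "E * Pc = E"
    and EE: "E * E = E" and nz: "E \<noteq> 0\<^sub>m (Suc k) (Suc k)"
  shows "E = limit_mat"
proof -
  define c where "c = E $$ (0, 0) / of_real (\<pi> $ 0)"
  have ent: "E $$ (i, j) = c * of_real (\<pi> $ j)" if "i < Suc k" "j < Suc k" for i j
    using fixed_columns_constant[OF E PE that] fixed_rows_multiple[OF E EP _ that(2), of 0]
    by (simp add: c_def)
  have "c \<noteq> 0"
  proof
    assume "c = 0"
    then have "E = 0\<^sub>m (Suc k) (Suc k)" using E ent by (intro eq_matI) auto
    with nz show False ..
  qed
  have "(E * E) $$ (0, 0) = (\<Sum>l<Suc k. E $$ (0, l) * E $$ (l, 0))"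
    using E by (simp add: scalar_prod_def lessThan_atLeast0 del: sum.lessThan_Suc)
  also have "\<dots> = (\<Sum>l<Suc k. of_real (\<pi> $ l) * (c * c * of_real (\<pi> $ 0)))"
    by (intro sum.cong) (simp_all add: ent)
  also have "\<dots> = c * c * of_real (\<pi> $ 0)"
    by (simp only: pi_sum_complex flip: sum_distrib_right) simp
  finally have "c = 1" using \<open>c \<noteq> 0\<close> pi_pos[of 0] by (simp add: EE ent)
  then show ?thesis using E ent by (intro eq_matI) (auto simp: limit_mat_def)
qed

text \<open>Averaging the constant columns of \<open>X\<close> with weights \<open>\<pi>\<close>
  reproduces them.\<close>

lemma limit_mat_absorbs:
  assumes X: "X \<in> carrier_mat (Suc k) n" and PX: "Pc * X = X"
  shows "limit_mat * X = X"
proof (rule eq_matI)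
  fix i j assume "i < dim_row X" "j < dim_col X"
  then have ij: "i < Suc k" "j < n" using X by auto
  have "(limit_mat * X) $$ (i, j) = (\<Sum>l<Suc k. of_real (\<pi> $ l) * X $$ (l, j))"
    using X ij by (simp add: limit_mat_def scalar_prod_def lessThan_atLeast0 del: sum.lessThan_Suc)
  also have "\<dots> = (\<Sum>l<Suc k. of_real (\<pi> $ l) * X $$ (i, j))"
    using fixed_columns_constant[OF X PX] ij by (intro sum.cong refl) (metis lessThan_iff)
  also have "\<dots> = X $$ (i, j)"
    by (simp only: pi_sum_complex flip: sum_distrib_right) simp
  finally show "(limit_mat * X) $$ (i, j) = X $$ (i, j)" .
qed (use X in \<open>auto simp: limit_mat_def\<close>)

context
  fixes R R' J :: "complex mat"
  assumes conj: "conjugation (Suc k) R R'"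
    and J: "J \<in> carrier_mat k k"
    and Pc_eq: "Pc = R' * border_diag 1 J * R"
begin

interpretation conjugation "Suc k" R R' by (rule conj)

lemma Pc_conj: "Pc = conj_mat (border_diag 1 J)"
  by (simp add: Pc_eq conj_mat_def)

text \<open>The right-hand side is a nonzero idempotent fixed by \<open>Pc\<close> on both sides, so
  \<open>limit_mat_unique\<close> applies whatever \<open>R\<close> and \<open>J\<close>
  are.\<close>

lemma limit_mat_conj: "limit_mat = conj_mat (border_diag 1 (0\<^sub>m k k))"
proof (rule limit_mat_unique[symmetric])
  let ?E = "border_diag (1::complex) (0\<^sub>m k k)"
  have E: "?E \<in> carrier_mat (Suc k) (Suc k)" by simp
  show "conj_mat ?E \<in> carrier_mat (Suc k) (Suc k)" by simp
  show "Pc * conj_mat ?E = conj_mat ?E"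
    unfolding Pc_conj using J by (simp add: conj_mat_mult mult_border_diag[of _ k])
  show "conj_mat ?E * Pc = conj_mat ?E"
    unfolding Pc_conj using J by (simp add: conj_mat_mult mult_border_diag[of _ k])
  show "conj_mat ?E * conj_mat ?E = conj_mat ?E"
    by (simp add: conj_mat_mult mult_border_diag[of _ k])
  show "conj_mat ?E \<noteq> 0\<^sub>m (Suc k) (Suc k)"
  proof
    assume "conj_mat ?E = 0\<^sub>m (Suc k) (Suc k)"
    then have "?E = 0\<^sub>m (Suc k) (Suc k)"
      using conj_mat_cancel[OF E] R R' by simp
    then have "?E $$ (0, 0) = 0" by simp
    then show False by (simp add: border_diag_eq[of _ k])
  qed
qed

text \<open>Simplicity of the eigenvalue 1: a fixed vector of \<open>J\<close> yields a matrix fixed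
  by \<open>Pc\<close>, which \<open>limit_mat\<close> must preserve, although in these coordinates
  \<open>limit_mat\<close> annihilates it.\<close>

lemma det_one_minus_J: "det (1\<^sub>m k - J) \<noteq> 0"
proof
  have carr: "1\<^sub>m k - J \<in> carrier_mat k k" using J by (rule minus_carrier_mat)
  assume "det (1\<^sub>m k - J) = 0"
  then obtain y where y: "y \<in> carrier_vec k" "y \<noteq> 0\<^sub>v k" "(1\<^sub>m k - J) *\<^sub>v y = 0\<^sub>v k"
    using det_0_iff_vec_prod_zero_field[OF carr] by blast
  have "1\<^sub>m k *\<^sub>v y - J *\<^sub>v y = 0\<^sub>v k"
    using y J by (simp add: minus_mult_distrib_mat_vec[of _ k k])
  then have Jy: "J *\<^sub>v y = y"
    using y(1) J by (auto simp: vec_eq_iff)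
  \<comment> \<open>The vector is repeated in every column so that the rules for bordered square
    matrices apply.\<close>
  define Y where "Y = mat k k (\<lambda>(i, j). y $ i)"
  have Y: "Y \<in> carrier_mat k k" by (simp add: Y_def)
  have "J * Y = Y"
  proof (rule eq_matI)
    fix i j assume ij: "i < dim_row Y" "j < dim_col Y"
    then have "col Y j = y" using y(1) by (intro eq_vecI) (auto simp: Y_def)
    then have "(J * Y) $$ (i, j) = (J *\<^sub>v y) $ i" using ij J by (simp add: Y_def)
    then show "(J * Y) $$ (i, j) = Y $$ (i, j)" using ij by (simp add: Jy Y_def)
  qed (use J in \<open>auto simp: Y_def\<close>)
  then have "Pc * conj_mat (border_diag 0 Y) = conj_mat (border_diag 0 Y)"
    unfolding Pc_conj using J Y by (simp add: conj_mat_mult mult_border_diag[of _ k])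
  then have "conj_mat (border_diag 0 Y) = limit_mat * conj_mat (border_diag 0 Y)"
    using limit_mat_absorbs[of "conj_mat (border_diag 0 Y)" "Suc k"] Y by simp
  also have "\<dots> = conj_mat (border_diag 0 (0\<^sub>m k k))"
    unfolding limit_mat_conj using Y by (simp add: conj_mat_mult mult_border_diag[of _ k])
  finally have "Y = 0\<^sub>m k k"
    using Y by (simp add: conj_mat_inject border_diag_inject[of _ k])
  then have "y = 0\<^sub>v k"
    using y(1) by (auto simp: Y_def mat_eq_iff vec_eq_iff)
  with y(2) show False ..
qed

text \<open>In the coordinates of \<open>R\<close>, the factor \<open>I - P + Q\<close> becomes
  \<open>diag(1, I - J)\<close>, which is invertible although \<open>I - P\<close> is singular, and
  \<open>P - (3/2) Q\<close> becomes \<open>diag(-1/2, J)\<close>. The right-hand side mentions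
  neither \<open>R\<close> nor \<open>J\<close>, so the covariance is well defined.\<close>

lemma potential_eq:
  "R' * border_diag (- 1 / 2) (J * inv_mat (1\<^sub>m k - J)) * R =
    (Pc - (3 / 2) \<cdot>\<^sub>m limit_mat) * inv_mat (1\<^sub>m (Suc k) - Pc + limit_mat)"
proof -
  let ?K = "inv_mat (1\<^sub>m k - J)"
  have carr: "1\<^sub>m k - J \<in> carrier_mat k k" using J by (rule minus_carrier_mat)
  note K = inv_mat_of_det[OF carr det_one_minus_J]
  have "1\<^sub>m (Suc k) - Pc + limit_mat =
      conj_mat (border_diag 1 (1\<^sub>m k) - border_diag 1 J + border_diag 1 (0\<^sub>m k k))"
    unfolding Pc_conj limit_mat_conj
    using J by (simp add: conj_mat_add conj_mat_minus border_diag_one conj_mat_one minus_carrier_mat)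
  also have "\<dots> = conj_mat (border_diag 1 (1\<^sub>m k - J))"
    using J carr by (simp add: border_diag_minus[of _ k] border_diag_add[of _ k] minus_carrier_mat)
  finally have F: "1\<^sub>m (Suc k) - Pc + limit_mat = conj_mat (border_diag 1 (1\<^sub>m k - J))" .
  have "inv_mat (1\<^sub>m (Suc k) - Pc + limit_mat) = conj_mat (border_diag 1 ?K)"
    unfolding F using carr K
    by (intro inv_mat_eqI[of _ "Suc k"])
      (simp_all add: conj_mat_mult mult_border_diag[of _ k] border_diag_one conj_mat_one)
  moreover have "Pc - (3 / 2) \<cdot>\<^sub>m limit_mat = conj_mat (border_diag (- 1 / 2) J)"
  proof -
    have "J - (3 / 2) \<cdot>\<^sub>m 0\<^sub>m k k = J" using J by (intro eq_matI) auto
    then have "border_diag (- 1 / 2) J = border_diag 1 J - (3 / 2) \<cdot>\<^sub>m border_diag 1 (0\<^sub>m k k)"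
      using J by (simp add: border_diag_smult[of _ k] border_diag_minus[of _ k])
    then show ?thesis
      unfolding Pc_conj limit_mat_conj using J by (simp add: conj_mat_minus conj_mat_smult)
  qed
  ultimately show ?thesis
    using J K by (simp add: conj_mat_mult mult_border_diag[of _ k]) (simp add: conj_mat_def)
qed

end

text \<open>A stationary vector is a multiple of \<open>\<pi>\<close>, and both have sum 1. This is
  needed because the description in \<open>asymptotic_covariance\<close> also quantifies over the
  stationary distribution.\<close>

lemma stationary_unique:
  assumes "stationary_distribution P \<rho>"
  shows "\<rho> = \<pi>"
proof -
  have dim: "dim_vec \<rho> = Suc k" using assms P by (simp add: stationary_distribution_def)
  have sum: "(\<Sum>i<Suc k. \<rho> $ i) = 1" and
    st: "\<And>j. j < Suc k \<Longrightarrow> (\<Sum>i<Suc k. \<rho> $ i * P $$ (i, j)) = \<rho> $ j"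
    using assms dim P unfolding stationary_distribution_def by (metis, metis carrier_matD(1))
  have mult: "\<rho> $ j = \<rho> $ 0 / \<pi> $ 0 * \<pi> $ j" if j: "j < Suc k" for j
  proof -
    have "complex_of_real (\<rho> $ j) = of_real (\<rho> $ 0) / of_real (\<pi> $ 0) * of_real (\<pi> $ j)"
    proof (rule left_fixed_multiple[of "\<lambda>i. of_real (\<rho> $ i)", OF _ j])
      fix j assume "j < Suc k"
      from arg_cong[OF st[OF this], of complex_of_real]
      show "(\<Sum>i<Suc k. complex_of_real (\<rho> $ i) * of_real (P $$ (i, j))) = of_real (\<rho> $ j)"
        by (simp del: sum.lessThan_Suc)
    qed
    then show ?thesis by (metis of_real_divide of_real_eq_iff of_real_mult)
  qed
  have "(\<Sum>i<Suc k. \<rho> $ i) = (\<Sum>i<Suc k. \<rho> $ 0 / \<pi> $ 0 * \<pi> $ i)"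
    using mult by (intro sum.cong refl) blast
  then have "\<rho> $ 0 / \<pi> $ 0 = 1" by (simp only: sum pi_sum mult_1_right flip: sum_distrib_left)
  then have "\<rho> $ j = \<pi> $ j" if "j < Suc k" for j
    using mult[OF that] by (metis mult_1)
  then show ?thesis using dim by (intro eq_vecI) auto
qed

subsection \<open>The orthogonal diagonalization\<close>

abbreviation h :: "real mat" where
  "h \<equiv> sqrt_diag \<pi>"

definition h_inv :: "real mat" where
  "h_inv = mat_diag (Suc k) (\<lambda>i. 1 / sqrt (\<pi> $ i))"

lemma h_eq: "h = mat_diag (Suc k) (\<lambda>i. sqrt (\<pi> $ i))"
  unfolding sqrt_diag_def diag_of_vec_def by (simp, rule mat_diag_cong) simp

lemma h_carrier [simp]: "h \<in> carrier_mat (Suc k) (Suc k)" "h_inv \<in> carrier_mat (Suc k) (Suc k)"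
  by (simp_all add: h_eq h_inv_def)

lemma transpose_h [simp]: "transpose_mat h = h" "transpose_mat h_inv = h_inv"
  by (simp_all add: h_eq h_inv_def)

lemma h_h_inv: "h * h_inv = 1\<^sub>m (Suc k)" "h_inv * h = 1\<^sub>m (Suc k)"
proof -
  have "mat_diag (Suc k) (\<lambda>i. sqrt (\<pi> $ i) * (1 / sqrt (\<pi> $ i))) = 1\<^sub>m (Suc k)"
    unfolding mat_diag_one[symmetric] by (rule mat_diag_cong) (use pi_pos in force)
  then show "h * h_inv = 1\<^sub>m (Suc k)" "h_inv * h = 1\<^sub>m (Suc k)"
    by (simp_all add: h_eq h_inv_def mult.commute)
qed

lemma h_h: "h * h = diag_of_vec \<pi>"
proof -
  have "h * h = mat_diag (Suc k) (\<lambda>i. sqrt (\<pi> $ i) * sqrt (\<pi> $ i))" by (simp add: h_eq)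
  also have "\<dots> = diag_of_vec \<pi>"
    unfolding diag_of_vec_def pi_dim by (rule mat_diag_cong) (simp add: pi_nonneg)
  finally show ?thesis .
qed

lemma conjugation_S_h:
  assumes S: "S \<in> carrier_mat (Suc k) (Suc k)" and SS: "transpose_mat S * S = 1\<^sub>m (Suc k)"
  shows "conjugation (Suc k) (S * h) (h_inv * transpose_mat S)"
proof
  note assoc = assoc_mult_mat[of _ "Suc k" "Suc k" _ "Suc k" _ "Suc k"]
  have St: "transpose_mat S \<in> carrier_mat (Suc k) (Suc k)" using S by simp
  show Sh: "S * h \<in> carrier_mat (Suc k) (Suc k)" using S by simp
  show hS: "h_inv * transpose_mat S \<in> carrier_mat (Suc k) (Suc k)"
    using S by (simp add: mult_carrier_mat[of _ "Suc k" "Suc k" _ "Suc k"])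
  have "h_inv * transpose_mat S * (S * h) = h_inv * (transpose_mat S * S) * h"
    using S St by (simp add: assoc mult_carrier_mat[of _ "Suc k" "Suc k" _ "Suc k"])
  also have "\<dots> = 1\<^sub>m (Suc k)" by (simp add: SS h_h_inv right_mult_one_mat[of _ "Suc k"])
  finally show "h_inv * transpose_mat S * (S * h) = 1\<^sub>m (Suc k)" .
  then show "S * h * (h_inv * transpose_mat S) = 1\<^sub>m (Suc k)"
    by (rule mat_mult_left_right_inverse[OF hS Sh])
qed

lemma inv_mat_S_h:
  assumes "S \<in> carrier_mat (Suc k) (Suc k)" and "transpose_mat S * S = 1\<^sub>m (Suc k)"
  shows "inv_mat (S * h) = h_inv * transpose_mat S"
  using conjugation_S_h[OF assms] by (intro inv_mat_eqI) (auto simp: conjugation_def)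

text \<open>For a square matrix one of the two orthogonality relations implies the other, and the
  inverse of \<open>S * h\<close> is explicit.\<close>

lemma orthogonal_diagonalization_iff:
  "orthogonal_diagonalization P \<pi> S l \<longleftrightarrow>
    S \<in> carrier_mat (Suc k) (Suc k) \<and> transpose_mat S * S = 1\<^sub>m (Suc k) \<and>
    P = h_inv * transpose_mat S * Lambda_mat (Suc k) l * (S * h)"
proof -
  have "real_orthogonal_mat S \<longleftrightarrow> transpose_mat S * S = 1\<^sub>m (Suc k)"
    if S: "S \<in> carrier_mat (Suc k) (Suc k)"
    using that mat_mult_left_right_inverse[of "transpose_mat S" "Suc k" S]
    by (auto simp: real_orthogonal_mat_def inverts_mat_def)
  then show ?thesis
    using inv_mat_S_h P by (auto simp: orthogonal_diagonalization_def)
qed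

text \<open>Detailed balance makes \<open>h * P * h_inv\<close> symmetric, and row sums 1 make the
  square roots of \<open>\<pi>\<close> a unit eigenvector for 1. With that vector as first row of
  \<open>S\<close>, the first row of \<open>S * h\<close> is \<open>\<pi>\<close>, as a Jordan
  decomposition demands.\<close>

lemma exists_orthogonal_diagonalization:
  obtains S l where "orthogonal_diagonalization P \<pi> S l" "row (S * h) 0 = \<pi>"
proof -
  note assoc = assoc_mult_mat[of _ "Suc k" "Suc k" _ "Suc k" _ "Suc k"]
  note carr = mult_carrier_mat[of _ "Suc k" "Suc k" _ "Suc k"]
  define A where "A = h * P * h_inv"
  have A: "A \<in> carrier_mat (Suc k) (Suc k)" unfolding A_def using P by (simp add: carr)
  have A_index: "A $$ (i, j) = sqrt (\<pi> $ i) * P $$ (i, j) / sqrt (\<pi> $ j)"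
    if "i < Suc k" "j < Suc k" for i j
    unfolding A_def h_eq h_inv_def using that P
    by (simp add: mat_diag_mult_left[of _ _ "Suc k"] mat_diag_mult_right[of _ "Suc k"])
  have sym: "transpose_mat A = A"
  proof (rule eq_matI)
    fix i j assume "i < dim_row A" "j < dim_col A"
    then have ij: "i < Suc k" "j < Suc k" using A by auto
    have "sqrt (\<pi> $ j) * sqrt (\<pi> $ j) * P $$ (j, i) = sqrt (\<pi> $ i) * sqrt (\<pi> $ i) * P $$ (i, j)"
      using reversible[OF ij] pi_nonneg ij by simp
    \<comment> \<open>Here \<open>s\<close> and \<open>t\<close> are the square roots of
      \<open>\<pi> $ i\<close> and \<open>\<pi> $ j\<close>: detailed balance is divided by
      \<open>s * t\<close>.\<close>
    moreover have "t * t * b = s * s * a \<Longrightarrow> s \<noteq> 0 \<Longrightarrow> t \<noteq> 0 \<Longrightarrow> t * b / s = s * a / t"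
      for s t a b :: real by (simp add: field_simps)
    ultimately have "A $$ (j, i) = A $$ (i, j)"
      using ij pi_pos[OF ij(1)] pi_pos[OF ij(2)] by (simp only: A_index) (simp del: real_sqrt_mult_self)
    then show "transpose_mat A $$ (i, j) = A $$ (i, j)" using ij A by simp
  qed (use A in auto)
  define v where "v = vec (Suc k) (\<lambda>i. sqrt (\<pi> $ i))"
  have v: "v \<in> carrier_vec (Suc k)" by (simp add: v_def)
  have "v \<bullet> v = (\<Sum>i<Suc k. \<pi> $ i)"
    unfolding v_def scalar_prod_def lessThan_atLeast0 by (intro sum.cong) (auto simp: pi_nonneg)
  then have unit: "v \<bullet> v = 1" by (simp only: pi_sum)
  have ev: "A *\<^sub>v v = 1 \<cdot>\<^sub>v v"
  proof (rule eq_vecI)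
    fix i assume "i < dim_vec (1 \<cdot>\<^sub>v v)"
    then have i: "i < Suc k" by (simp add: v_def)
    have "(A *\<^sub>v v) $ i = (\<Sum>j<Suc k. A $$ (i, j) * sqrt (\<pi> $ j))"
      using i A by (simp add: v_def scalar_prod_def lessThan_atLeast0 del: sum.lessThan_Suc)
    also have "\<dots> = (\<Sum>j<Suc k. sqrt (\<pi> $ i) * P $$ (i, j))"
    proof (rule sum.cong[OF refl])
      fix j assume "j \<in> {..<Suc k}"
      then show "A $$ (i, j) * sqrt (\<pi> $ j) = sqrt (\<pi> $ i) * P $$ (i, j)"
        using A_index[OF i, of j] pi_pos[of j] by simp
    qed
    also have "\<dots> = sqrt (\<pi> $ i)" by (simp only: P_row_sum[OF i] mult_1_right flip: sum_distrib_left)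
    finally show "(A *\<^sub>v v) $ i = (1 \<cdot>\<^sub>v v) $ i" using i by (simp add: v_def)
  qed (use A in \<open>simp add: v_def\<close>)
  obtain S d where S: "S \<in> carrier_mat (Suc k) (Suc k)" "transpose_mat S * S = 1\<^sub>m (Suc k)"
    and row: "row S 0 = v" and d: "d 0 = 1"
    and Aeq: "A = transpose_mat S * mat_diag (Suc k) d * S"
    using spectral_deflation[OF A sym v unit ev real_symmetric_spectral] by blast
  have dL: "mat_diag (Suc k) d = Lambda_mat (Suc k) d"
    unfolding Lambda_mat_def by (rule mat_diag_cong) (simp add: d)
  have St: "transpose_mat S \<in> carrier_mat (Suc k) (Suc k)"
    using S by (simp add: mult_carrier_mat[of _ "Suc k" "Suc k" _ "Suc k"])
  have "h_inv * A * h = (h_inv * h) * P * (h_inv * h)"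
    unfolding A_def using P by (simp add: assoc carr)
  then have "P = h_inv * A * h" using P by (simp add: h_h_inv)
  also have "\<dots> = h_inv * transpose_mat S * Lambda_mat (Suc k) d * (S * h)"
    unfolding Aeq dL using S(1) St by (simp add: assoc carr)
  finally have "orthogonal_diagonalization P \<pi> S d"
    using S orthogonal_diagonalization_iff by blast
  moreover have "row (S * h) 0 = \<pi>"
  proof (rule eq_vecI)
    fix j assume "j < dim_vec \<pi>"
    then have j: "j < Suc k" by simp
    have "row (S * h) 0 $ j = row S 0 $ j * sqrt (\<pi> $ j)"
      unfolding h_eq using S(1) j by (simp add: mat_diag_mult_right[of _ "Suc k"])
    then show "row (S * h) 0 $ j = \<pi> $ j" using j by (simp add: row v_def pi_nonneg)
  qed (simp add: carrier_matD(2)[OF h_carrier(1)])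
  ultimately show ?thesis by (rule that)
qed

section \<open>Evaluation of the covariance in an orthogonal diagonalization\<close>

context
  fixes S :: "real mat" and l :: "nat \<Rightarrow> real"
  assumes od: "orthogonal_diagonalization P \<pi> S l"
begin

abbreviation R :: "real mat" where "R \<equiv> S * h"
abbreviation R' :: "real mat" where "R' \<equiv> h_inv * transpose_mat S"
abbreviation Rc :: "complex mat" where "Rc \<equiv> map_mat complex_of_real R"
abbreviation R'c :: "complex mat" where "R'c \<equiv> map_mat complex_of_real R'"
abbreviation Jc :: "complex mat" where "Jc \<equiv> mat_diag k (\<lambda>i. complex_of_real (l (Suc i)))"

lemma S_carrier: "S \<in> carrier_mat (Suc k) (Suc k)" "transpose_mat S \<in> carrier_mat (Suc k) (Suc k)"
  and SS: "transpose_mat S * S = 1\<^sub>m (Suc k)"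
  and P_eq: "P = R' * Lambda_mat (Suc k) l * R"
  using od by (auto simp: orthogonal_diagonalization_iff)

interpretation conjugation "Suc k" R R'
  by (rule conjugation_S_h[OF S_carrier(1) SS])

lemma conjugation_complex: "conjugation (Suc k) Rc R'c"
  using R R' RR' R'R
  by unfold_locales (simp_all add: of_real_hom.mat_hom_one
      flip: of_real_hom.mat_hom_mult[of _ "Suc k" "Suc k" _ "Suc k"])

lemma map_of_real_Lambda: "map_mat complex_of_real (Lambda_mat (Suc k) l) = border_diag 1 Jc"
  by (simp add: Lambda_mat_border map_border_diag[of _ k] map_mat_diag)

lemma Pc_decomposition: "Pc = R'c * border_diag 1 Jc * Rc"
  unfolding map_of_real_Lambda[symmetric] using R R' by (subst P_eq) (simp add: map_of_real_mult3)

lemmas decomposition = conjugation_complex mat_diag_dim[of k] Pc_decomposition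

text \<open>Otherwise \<open>1\<^sub>m k - Jc\<close> would have a zero row, contradicting its
  invertibility. This legitimizes the divisions in \<open>D_mat\<close>.\<close>

lemma eigenvalue_ne_1:
  assumes "0 < i" "i < Suc k"
  shows "l i \<noteq> 1"
proof
  assume l: "l i = 1"
  let ?A = "1\<^sub>m k - Jc"
  have A: "?A \<in> carrier_mat k k" by (rule minus_carrier_mat) simp
  obtain j where j: "i = Suc j" "j < k" using assms by (cases i) auto
  have "(?A * inv_mat ?A) $$ (j, j) = (\<Sum>n<k. ?A $$ (j, n) * inv_mat ?A $$ (n, j))"
    using inv_mat_of_det(1)[OF A det_one_minus_J[OF decomposition]] j A
    by (simp add: scalar_prod_def lessThan_atLeast0 del: index_minus_mat)
  also have "\<dots> = 0"
    using l j by (intro sum.neutral) (auto simp: mat_diag_def)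
  finally show False
    using inv_mat_of_det(2)[OF A det_one_minus_J[OF decomposition]] j by simp
qed

lemma limit_mat_eq: "limit_mat = map_mat complex_of_real (R' * Lambda_mat (Suc k) (\<lambda>_. 0) * R)"
proof -
  have "map_mat complex_of_real (Lambda_mat (Suc k) (\<lambda>_. 0)) = border_diag 1 (0\<^sub>m k k)"
    by (intro eq_matI) (auto simp: Lambda_mat_def mat_diag_def border_diag_eq[of _ k])
  then show ?thesis
    using limit_mat_conj[OF decomposition] conjugation.conj_mat_def[OF conjugation_complex] R R'
    by (simp add: map_of_real_mult3)
qed

lemma potential_real:
  "map_mat complex_of_real (R' * D_mat (Suc k) l * R) =
    (Pc - (3 / 2) \<cdot>\<^sub>m limit_mat) * inv_mat (1\<^sub>m (Suc k) - Pc + limit_mat)"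
proof -
  let ?K = "mat_diag k (\<lambda>i. 1 / (1 - complex_of_real (l (Suc i))))"
  have "1\<^sub>m k - Jc = mat_diag k (\<lambda>i. 1 - complex_of_real (l (Suc i)))"
    by (intro eq_matI) (auto simp: mat_diag_def)
  moreover have "mat_diag k (\<lambda>i. (1 - complex_of_real (l (Suc i))) *
      (1 / (1 - complex_of_real (l (Suc i))))) = 1\<^sub>m k"
    unfolding mat_diag_one[symmetric]
    by (rule mat_diag_cong) (use eigenvalue_ne_1 in \<open>simp add: complex_eq_iff\<close>)
  ultimately have "inv_mat (1\<^sub>m k - Jc) = ?K"
    by (intro inv_mat_eqI[of _ k]) (simp_all only: mat_diag_diag mat_diag_dim)
  then have "map_mat complex_of_real (D_mat (Suc k) l) =
      border_diag (- 1 / 2) (Jc * inv_mat (1\<^sub>m k - Jc))"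
    by (simp add: D_mat_border map_border_diag[of _ k] map_mat_diag)
  then show ?thesis
    unfolding potential_eq[OF decomposition, symmetric]
    using R R' by (simp add: map_of_real_mult3)
qed

text \<open>The decomposition \<open>T\<close>, \<open>J\<close> is unrelated to \<open>S\<close>:
  the two are compared through the intrinsic expression of \<open>potential_eq\<close>.\<close>

lemma covariance_of_decomposition_eq:
  assumes "jordan_decomposition P \<pi> T J"
  shows "covariance_of_decomposition \<pi> T J = map_mat complex_of_real
    (diag_of_vec \<pi> + diag_of_vec \<pi> * conj_mat (D_mat (Suc k) l)
      + transpose_mat (conj_mat (D_mat (Suc k) l)) * diag_of_vec \<pi>)"
proof -
  have T: "T \<in> carrier_mat (Suc k) (Suc k)" "invertible_mat T"
    and J: "J \<in> carrier_mat k k" and eq: "Pc = inv_mat T * border_diag 1 J * T"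
    using assms P by (auto simp: jordan_decomposition_def)
  have "conjugation (Suc k) T (inv_mat T)"
    using inv_mat_inverse[OF T] T(1) by unfold_locales
  from potential_eq[OF this J eq]
  have M: "inv_mat T * border_diag (- 1 / 2) (J * inv_mat (1\<^sub>m (dim_row J) - J)) * T =
      map_mat complex_of_real (conj_mat (D_mat (Suc k) l))"
    using J by (simp add: potential_real conj_mat_def)
  have "diag_of_vec (map_vec complex_of_real \<pi>) = map_mat complex_of_real (diag_of_vec \<pi>)"
    unfolding diag_of_vec_def by (simp add: map_mat_diag, rule mat_diag_cong) simp
  moreover have "diag_of_vec \<pi> \<in> carrier_mat (Suc k) (Suc k)" by (simp add: diag_of_vec_def)
  ultimately show ?thesis
    unfolding covariance_of_decomposition_def Let_def M
    by (simp add: map_mat_transpose of_real_hom.mat_hom_mult[of _ "Suc k" "Suc k" _ "Suc k"]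
        map_of_real_add[of _ "Suc k"] mult_carrier_mat[of _ "Suc k" "Suc k" _ "Suc k"])
qed

lemma exists_jordan_decomposition:
  assumes "row R 0 = \<pi>"
  shows "jordan_decomposition P \<pi> Rc Jc"
proof -
  interpret c: conjugation "Suc k" Rc R'c by (rule conjugation_complex)
  have "inv_mat Rc = R'c" using c.R c.R' c.RR' by (rule inv_mat_eqI)
  moreover have "invertible_mat Rc"
    using c.R c.R' c.RR' c.R'R unfolding invertible_mat_def inverts_mat_def
    by (metis carrier_matD square_mat.simps)
  moreover have "row Rc 0 = map_vec complex_of_real (row R 0)"
    using R by (intro eq_vecI) auto
  then have "row Rc 0 = map_vec complex_of_real \<pi>" by (simp only: assms)
  ultimately show ?thesis
    using P c.R Pc_decomposition by (simp add: jordan_decomposition_def lower_jordan_mat_diag)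
qed

text \<open>Writing the diagonal matrix of \<open>\<pi>\<close> as \<open>h * h\<close> cancels the
  \<open>h_inv\<close> of the conjugation.\<close>

lemma diag_pi_mult_conj:
  assumes X: "X \<in> carrier_mat (Suc k) (Suc k)"
  shows "diag_of_vec \<pi> * conj_mat X = h * transpose_mat S * X * S * h"
proof -
  note assoc = assoc_mult_mat[of _ "Suc k" "Suc k" _ "Suc k" _ "Suc k"]
  note carr = mult_carrier_mat[of _ "Suc k" "Suc k" _ "Suc k"]
  have "diag_of_vec \<pi> * conj_mat X = h * (h * h_inv) * transpose_mat S * X * S * h"
    unfolding h_h[symmetric] conj_mat_def using X S_carrier by (simp add: assoc carr)
  then show ?thesis by (simp add: h_h_inv right_mult_one_mat[of _ "Suc k"])
qed

text \<open>The second summand is symmetric and the third is its transpose, which accounts for the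
  factor 2.\<close>

lemma covariance_symmetric_form:
  "diag_of_vec \<pi> + diag_of_vec \<pi> * conj_mat (D_mat (Suc k) l)
      + transpose_mat (conj_mat (D_mat (Suc k) l)) * diag_of_vec \<pi> =
    h * transpose_mat S * (1\<^sub>m (Suc k) + 2 \<cdot>\<^sub>m D_mat (Suc k) l) * S * h"
  (is "_ + ?PM + ?MP = _")
proof -
  let ?N = "Suc k" and ?D = "D_mat (Suc k) l"
  note assoc = assoc_mult_mat[of _ ?N ?N _ ?N _ ?N]
  note carr = mult_carrier_mat[of _ ?N ?N _ ?N]
  note S = S_carrier
  let ?f = "\<lambda>X. h * transpose_mat S * X * S * h"
  have add: "?f (X + Y) = ?f X + ?f Y"
    if "X \<in> carrier_mat ?N ?N" "Y \<in> carrier_mat ?N ?N" for X Y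
    using that S by (simp add: mult_add_distrib_mat[of _ ?N ?N _ ?N]
        add_mult_distrib_mat[of _ ?N ?N _ _ ?N] carr)
  have "?f (1\<^sub>m ?N) = h * (transpose_mat S * S) * h" using S by (simp add: assoc carr)
  also have "\<dots> = diag_of_vec \<pi>" by (simp add: SS h_h right_mult_one_mat[of _ ?N])
  finally have 1: "diag_of_vec \<pi> = ?f (1\<^sub>m ?N)" by simp
  have 2: "?PM = ?f ?D" by (simp add: diag_pi_mult_conj)
  have D: "transpose_mat ?D = ?D" by (simp add: D_mat_def)
  have Mt: "transpose_mat (conj_mat ?D) = h * transpose_mat S * ?D * (S * h_inv)"
    unfolding conj_mat_def transpose_mult_mult[OF R' D_mat_carrier R] D
    using S by (simp add: transpose_mult[of _ ?N ?N _ ?N])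
  have "?MP = h * transpose_mat S * ?D * S * (h_inv * h) * h"
    unfolding h_h[symmetric] Mt using S by (simp add: assoc carr)
  then have 3: "?MP = ?f ?D" using S by (simp add: h_h_inv carr right_mult_one_mat[of _ ?N ?N])
  have "1\<^sub>m ?N + 2 \<cdot>\<^sub>m ?D = 1\<^sub>m ?N + ?D + ?D"
    by (intro eq_matI) (auto simp: D_mat_def mat_diag_def)
  then show ?thesis unfolding 2 3 unfolding 1 by (simp add: add)
qed

end

lemma asymptotic_covariance_eq:
  assumes od: "orthogonal_diagonalization P \<pi> S l"
  shows "asymptotic_covariance P =
    h * transpose_mat S * (1\<^sub>m (Suc k) + 2 \<cdot>\<^sub>m D_mat (Suc k) l) * S * h" (is "_ = ?\<Sigma>")
proof -
  note cov = covariance_of_decomposition_eq[OF od, unfolded covariance_symmetric_form[OF od]]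
  \<comment> \<open>The first row of the given \<open>S\<close> is fixed only up to sign, so a
    second, normalized diagonalization witnesses existence; the value is still computed with
    \<open>S\<close>.\<close>
  obtain S0 l0 where od0: "orthogonal_diagonalization P \<pi> S0 l0" and row: "row (S0 * h) 0 = \<pi>"
    using exists_orthogonal_diagonalization .
  note jd = exists_jordan_decomposition[OF od0 row]
  show ?thesis
    unfolding asymptotic_covariance_def
  proof (rule the_equality)
    show "\<exists>\<rho> T J. stationary_distribution P \<rho> \<and> jordan_decomposition P \<rho> T J \<and>
        map_mat complex_of_real ?\<Sigma> = covariance_of_decomposition \<rho> T J"
      using stat jd cov[OF jd] by metis
  next
    fix \<Sigma>'
    assume "\<exists>\<rho> T J. stationary_distribution P \<rho> \<and> jordan_decomposition P \<rho> T J \<and>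
        map_mat complex_of_real \<Sigma>' = covariance_of_decomposition \<rho> T J"
    then show "\<Sigma>' = ?\<Sigma>"
      using stationary_unique cov of_real_hom.mat_hom_inj by metis
  qed
qed

end

subsection \<open>Doubly stochastic chains\<close>

lemma reversible_markov_uiid:
  "reversible_markov k (uiid_mat (Suc k)) (vec (Suc k) (\<lambda>_. 1 / real (Suc k)))"
proof
  show "irreducible_chain (uiid_mat (Suc k))"
    unfolding irreducible_chain_def by (intro allI impI exI[of _ 1]) simp
qed (auto simp: stochastic_mat_def stationary_distribution_def reversible_chain_def)

context reversible_markov
begin

text \<open>Unit column sums make the uniform vector stationary.\<close>

lemma doubly_stochastic_uniform:
  assumes "doubly_stochastic_mat P"
  shows "\<pi> = vec (Suc k) (\<lambda>_. 1 / real (Suc k))"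
proof (rule stationary_unique[symmetric])
  have "(\<Sum>i<Suc k. P $$ (i, j)) = 1" if "j < Suc k" for j
    using assms P that unfolding doubly_stochastic_mat_def by (metis carrier_matD(1))
  then show "stationary_distribution P (vec (Suc k) (\<lambda>_. 1 / real (Suc k)))"
    using P by (simp add: stationary_distribution_def flip: sum_divide_distrib del: sum.lessThan_Suc)
qed

text \<open>With \<open>\<pi>\<close> uniform, detailed balance is symmetry; conversely, symmetry
  turns row sums into column sums.\<close>

lemma doubly_stochastic_iff_symmetric: "doubly_stochastic_mat P \<longleftrightarrow> transpose_mat P = P"
proof
  assume "doubly_stochastic_mat P"
  note pi = doubly_stochastic_uniform[OF this]
  have "P $$ (j, i) = P $$ (i, j)" if "i < Suc k" "j < Suc k" for i j
    using reversible[OF that] that by (simp add: pi)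
  then show "transpose_mat P = P" using P by (intro eq_matI) auto
next
  assume sym: "transpose_mat P = P"
  have "(\<Sum>i<Suc k. P $$ (i, j)) = 1" if j: "j < Suc k" for j
  proof -
    have "(\<Sum>i<Suc k. P $$ (i, j)) = (\<Sum>i<Suc k. P $$ (j, i))"
      by (rule sum.cong) (use symmetric_mat_index[OF sym P _ j] in auto)
    then show ?thesis using P_row_sum[OF j] by simp
  qed
  then show "doubly_stochastic_mat P"
    using stoch P by (simp add: doubly_stochastic_mat_def del: sum.lessThan_Suc)
qed

lemma diag_pi_cancel:
  assumes A: "A \<in> carrier_mat (Suc k) (Suc k)" and B: "B \<in> carrier_mat (Suc k) (Suc k)"
  shows "diag_of_vec \<pi> * A = diag_of_vec \<pi> * B \<longleftrightarrow> A = B"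
proof
  assume eq: "diag_of_vec \<pi> * A = diag_of_vec \<pi> * B"
  have ent: "(diag_of_vec \<pi> * X) $$ (i, j) = \<pi> $ i * X $$ (i, j)"
    if "i < Suc k" "j < Suc k" "X \<in> carrier_mat (Suc k) (Suc k)" for i j and X :: "real mat"
    using that by (simp add: diag_of_vec_def mat_diag_mult_left[of _ _ "Suc k"])
  show "A = B"
  proof (rule eq_matI)
    fix i j assume "i < dim_row B" "j < dim_col B"
    then have ij: "i < Suc k" "j < Suc k" using B by auto
    then have "\<pi> $ i * A $$ (i, j) = \<pi> $ i * B $$ (i, j)"
      using eq A B by (metis ent)
    then show "A $$ (i, j) = B $$ (i, j)" using pi_pos[OF ij(1)] by simp
  qed (use A B in auto)
qed simp

section \<open>Comparison with the uniform chain in a common eigenbasis\<close>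

context
  fixes S :: "real mat" and l :: "nat \<Rightarrow> real"
  assumes od: "orthogonal_diagonalization P \<pi> S l" and ds: "doubly_stochastic_mat P"
begin

interpretation conjugation "Suc k" "S * h" "h_inv * transpose_mat S"
  by (rule conjugation_S_h[OF S_carrier(1)[OF od] SS[OF od]])

lemma P_conj: "P = conj_mat (Lambda_mat (Suc k) l)"
  using P_eq[OF od] by (simp add: conj_mat_def)

text \<open>For uniform \<open>\<pi>\<close> the projection \<open>limit_mat\<close> is the uniform
  matrix, so \<open>S\<close> diagonalizes it too, with eigenvalues 1, 0, ..., 0.\<close>

lemma uiid_conj: "uiid_mat (Suc k) = conj_mat (Lambda_mat (Suc k) (\<lambda>_. 0))"
proof -
  have "limit_mat = map_mat complex_of_real (uiid_mat (Suc k))"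
  proof (rule eq_matI)
    fix i j
    assume "i < dim_row (map_mat complex_of_real (uiid_mat (Suc k)))"
      "j < dim_col (map_mat complex_of_real (uiid_mat (Suc k)))"
    moreover from this have "\<pi> $ j = 1 / real (Suc k)"
      by (subst doubly_stochastic_uniform[OF ds]) simp
    ultimately show "limit_mat $$ (i, j) = map_mat complex_of_real (uiid_mat (Suc k)) $$ (i, j)"
      by (simp add: limit_mat_def)
  qed (simp_all add: limit_mat_def)
  then show ?thesis
    unfolding limit_mat_eq[OF od] conj_mat_def by (rule of_real_hom.mat_hom_inj[symmetric])
qed

lemma covariance_conj:
  "asymptotic_covariance P = diag_of_vec \<pi> * conj_mat (1\<^sub>m (Suc k) + 2 \<cdot>\<^sub>m D_mat (Suc k) l)"
  by (subst diag_pi_mult_conj[OF od]) (simp_all add: asymptotic_covariance_eq[OF od])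

lemma covariance_uiid_conj:
  "asymptotic_covariance (uiid_mat (Suc k)) =
    diag_of_vec \<pi> * conj_mat (1\<^sub>m (Suc k) + 2 \<cdot>\<^sub>m D_mat (Suc k) (\<lambda>_. 0))"
proof -
  interpret U: reversible_markov k "uiid_mat (Suc k)" \<pi>
    unfolding doubly_stochastic_uniform[OF ds] by (rule reversible_markov_uiid)
  have od_U: "orthogonal_diagonalization (uiid_mat (Suc k)) \<pi> S (\<lambda>_. 0)"
    unfolding U.orthogonal_diagonalization_iff
    using uiid_conj[unfolded conj_mat_def] S_carrier(1)[OF od] SS[OF od] by blast
  show ?thesis
    unfolding U.asymptotic_covariance_eq[OF od_U]
    by (rule diag_pi_mult_conj[OF od, symmetric]) simp
qed

text \<open>The leading entry \<open>-1/2\<close> of \<open>D_mat\<close> is chosen to give 0 here,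
  so index 0 imposes no condition when covariances are compared.\<close>

lemma one_plus_2_D:
  "1\<^sub>m (Suc k) + 2 \<cdot>\<^sub>m D_mat (Suc k) f =
    mat_diag (Suc k) (\<lambda>i. if i = 0 then 0 else 1 + 2 * (f i / (1 - f i)))"
  by (intro eq_matI) (auto simp: D_mat_def mat_diag_def)

text \<open>Cancelling \<open>\<pi>\<close> and the conjugation leaves two diagonals to compare; the
  uniform chain contributes 0, 1, ..., 1.\<close>

lemma covariance_rescaled_iff:
  "asymptotic_covariance P = a \<cdot>\<^sub>m asymptotic_covariance (uiid_mat (Suc k)) \<longleftrightarrow>
    (\<forall>i. 0 < i \<and> i < Suc k \<longrightarrow> 1 + 2 * (l i / (1 - l i)) = a)"
proof -
  let ?X = "\<lambda>f. 1\<^sub>m (Suc k) + 2 \<cdot>\<^sub>m D_mat (Suc k) f"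
  have X: "?X f \<in> carrier_mat (Suc k) (Suc k)" for f by simp
  have Pi: "diag_of_vec \<pi> \<in> carrier_mat (Suc k) (Suc k)" by (simp add: diag_of_vec_def)
  have "a \<cdot>\<^sub>m asymptotic_covariance (uiid_mat (Suc k)) = diag_of_vec \<pi> * conj_mat (a \<cdot>\<^sub>m ?X (\<lambda>_. 0))"
    unfolding covariance_uiid_conj conj_mat_smult[OF X]
    by (rule mult_smult_distrib[OF Pi conj_mat_carrier[OF X], symmetric])
  then have "asymptotic_covariance P = a \<cdot>\<^sub>m asymptotic_covariance (uiid_mat (Suc k)) \<longleftrightarrow>
      ?X l = a \<cdot>\<^sub>m ?X (\<lambda>_. 0)"
    unfolding covariance_conj
    by (simp only: diag_pi_cancel conj_mat_inject conj_mat_carrier smult_carrier_mat X)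
  also have "a \<cdot>\<^sub>m ?X (\<lambda>_. 0) = mat_diag (Suc k) (\<lambda>i. if i = 0 then 0 else a)"
    unfolding one_plus_2_D by (intro eq_matI) (auto simp: mat_diag_def)
  finally show ?thesis unfolding one_plus_2_D mat_diag_inject by auto
qed

lemma lazy_uiid_iff:
  "P = \<alpha> \<cdot>\<^sub>m uiid_mat (Suc k) + (1 - \<alpha>) \<cdot>\<^sub>m 1\<^sub>m (Suc k) \<longleftrightarrow>
    (\<forall>i. 0 < i \<and> i < Suc k \<longrightarrow> l i = 1 - \<alpha>)"
proof -
  have "\<alpha> \<cdot>\<^sub>m uiid_mat (Suc k) + (1 - \<alpha>) \<cdot>\<^sub>m 1\<^sub>m (Suc k) =
      conj_mat (\<alpha> \<cdot>\<^sub>m Lambda_mat (Suc k) (\<lambda>_. 0) + (1 - \<alpha>) \<cdot>\<^sub>m 1\<^sub>m (Suc k))"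
    unfolding uiid_conj by (simp add: conj_mat_add conj_mat_smult conj_mat_one)
  also have "\<alpha> \<cdot>\<^sub>m Lambda_mat (Suc k) (\<lambda>_. 0) + (1 - \<alpha>) \<cdot>\<^sub>m 1\<^sub>m (Suc k) =
      mat_diag (Suc k) (\<lambda>i. if i = 0 then 1 else 1 - \<alpha>)"
    by (intro eq_matI) (auto simp: Lambda_mat_def mat_diag_def)
  finally have "P = \<alpha> \<cdot>\<^sub>m uiid_mat (Suc k) + (1 - \<alpha>) \<cdot>\<^sub>m 1\<^sub>m (Suc k) \<longleftrightarrow>
      Lambda_mat (Suc k) l = mat_diag (Suc k) (\<lambda>i. if i = 0 then 1 else 1 - \<alpha>)"
    using P_conj conj_mat_inject by (metis Lambda_mat_carrier mat_diag_dim)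
  then show ?thesis unfolding Lambda_mat_def mat_diag_inject by auto
qed

text \<open>The bound expresses that the diagonal entry \<open>1 - \<alpha> * (m - 1) / m\<close>,
  with \<open>m = Suc k\<close>, is nonnegative.\<close>

lemma lazy_uiid_bound:
  assumes "P = \<alpha> \<cdot>\<^sub>m uiid_mat (Suc k) + (1 - \<alpha>) \<cdot>\<^sub>m 1\<^sub>m (Suc k)" and "0 < k"
  shows "\<alpha> \<le> real (Suc k) / (real (Suc k) - 1)"
proof -
  have "P $$ (0, 0) = \<alpha> * (1 / real (Suc k)) + (1 - \<alpha>)" by (subst assms(1)) simp
  then have "0 \<le> \<alpha> * (1 / real (Suc k)) + (1 - \<alpha>)" using P_nonneg[of 0 0] by simp
  then show ?thesis using assms(2) by (simp add: field_simps)
qed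

text \<open>Only for two letters does the bound on \<^term>\<open>\<alpha>\<close> allow the value 2; the chain then flips
  deterministically between the letters, so it is periodic.\<close>
lemma lazy_uiid_less_2:
  assumes eq: "P = \<alpha> \<cdot>\<^sub>m uiid_mat (Suc k) + (1 - \<alpha>) \<cdot>\<^sub>m 1\<^sub>m (Suc k)" and "0 < k"
    and aper: "aperiodic_chain P"
  shows "\<alpha> < 2"
proof (rule ccontr)
  assume "\<not> \<alpha> < 2"
  then have "2 \<le> real (Suc k) / (real (Suc k) - 1)"
    using lazy_uiid_bound[OF eq \<open>0 < k\<close>] by simp
  then have k: "k = 1" using \<open>0 < k\<close> by (simp add: field_simps)
  then have \<alpha>: "\<alpha> = 2" using lazy_uiid_bound[OF eq \<open>0 < k\<close>] \<open>\<not> \<alpha> < 2\<close> by simp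
  have "P $$ (0, 0) = 0" by (subst eq) (simp add: k \<alpha>)
  \<comment> \<open>For \<open>\<alpha> = 2\<close> the eigenvalues are 1 and -1, so
    \<open>P\<close> is an involution.\<close>
  have "Lambda_mat (Suc k) l * Lambda_mat (Suc k) l = 1\<^sub>m (Suc k)"
    unfolding Lambda_mat_def mat_diag_diag mat_diag_one[symmetric]
    using iffD1[OF lazy_uiid_iff eq] by (intro mat_diag_cong) (simp add: \<alpha>)
  then have "P * P = 1\<^sub>m (Suc k)" by (subst (1 2) P_conj) (simp add: conj_mat_mult conj_mat_one)
  then have "even n" if "(P ^\<^sub>m n) $$ (0, 0) > 0" for n
    using that \<open>P $$ (0, 0) = 0\<close> involution_pow_mat[OF P, of n] by (auto split: if_splits)
  then have "2 dvd Gcd {n::nat. n > 0 \<and> (P ^\<^sub>m n) $$ (0, 0) > 0}"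
    by (intro Gcd_greatest) auto
  then show False using aper P by (auto simp: aperiodic_chain_def)
qed

lemma rescaled_iff_lazy_uiid:
  assumes k: "0 < k" and aper: "aperiodic_chain P"
  shows "(\<exists>a>0. asymptotic_covariance P = a \<cdot>\<^sub>m asymptotic_covariance (uiid_mat (Suc k))) \<longleftrightarrow>
    (\<exists>\<alpha>. 0 < \<alpha> \<and> \<alpha> \<le> real (Suc k) / (real (Suc k) - 1) \<and>
      P = \<alpha> \<cdot>\<^sub>m uiid_mat (Suc k) + (1 - \<alpha>) \<cdot>\<^sub>m 1\<^sub>m (Suc k))"
proof
  assume "\<exists>a>0. asymptotic_covariance P = a \<cdot>\<^sub>m asymptotic_covariance (uiid_mat (Suc k))"
  then obtain a where a: "0 < a" "\<And>i. 0 < i \<Longrightarrow> i < Suc k \<Longrightarrow> 1 + 2 * (l i / (1 - l i)) = a"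
    unfolding covariance_rescaled_iff by blast
  \<comment> \<open>Solving \<open>(1 + l i) / (1 - l i) = a\<close> for \<open>l i\<close> yields
    the witness \<open>2 / (1 + a)\<close> for \<open>\<alpha>\<close>.\<close>
  have "l i = 1 - 2 / (1 + a)" if "0 < i" "i < Suc k" for i
    using a(1) a(2)[OF that] eigenvalue_ne_1[OF od that] by (simp add: field_simps)
  then have eq: "P = (2 / (1 + a)) \<cdot>\<^sub>m uiid_mat (Suc k) + (1 - 2 / (1 + a)) \<cdot>\<^sub>m 1\<^sub>m (Suc k)"
    using lazy_uiid_iff by blast
  show "\<exists>\<alpha>. 0 < \<alpha> \<and> \<alpha> \<le> real (Suc k) / (real (Suc k) - 1) \<and>
      P = \<alpha> \<cdot>\<^sub>m uiid_mat (Suc k) + (1 - \<alpha>) \<cdot>\<^sub>m 1\<^sub>m (Suc k)"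
    using eq lazy_uiid_bound[OF eq k] a(1) by (intro exI[of _ "2 / (1 + a)"] conjI) simp_all
next
  assume "\<exists>\<alpha>. 0 < \<alpha> \<and> \<alpha> \<le> real (Suc k) / (real (Suc k) - 1) \<and>
      P = \<alpha> \<cdot>\<^sub>m uiid_mat (Suc k) + (1 - \<alpha>) \<cdot>\<^sub>m 1\<^sub>m (Suc k)"
  then obtain \<alpha> where \<alpha>: "0 < \<alpha>" and
    eq: "P = \<alpha> \<cdot>\<^sub>m uiid_mat (Suc k) + (1 - \<alpha>) \<cdot>\<^sub>m 1\<^sub>m (Suc k)" by blast
  have "1 + 2 * (l i / (1 - l i)) = 2 / \<alpha> - 1" if "0 < i" "i < Suc k" for i
  proof -
    have "l i = 1 - \<alpha>" using lazy_uiid_iff eq that by blast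
    then show ?thesis using \<alpha> by (simp add: field_simps)
  qed
  \<comment> \<open>The upper bound on \<open>\<alpha>\<close> alone would admit the factor 0 for
    two letters; aperiodicity excludes it.\<close>
  moreover have "0 < 2 / \<alpha> - 1" using \<alpha> lazy_uiid_less_2[OF eq k aper] by (simp add: field_simps)
  ultimately show "\<exists>a>0. asymptotic_covariance P = a \<cdot>\<^sub>m asymptotic_covariance (uiid_mat (Suc k))"
    using covariance_rescaled_iff by blast
qed

end

end

theorem theorem4p3:
  fixes m :: nat and P :: "real mat" and \<pi> :: "real vec"
  assumes "m \<ge> 2"
    and "P \<in> carrier_mat m m"
    and "stochastic_mat P"
    and "irreducible_chain P"
    and "aperiodic_chain P"
    and "stationary_distribution P \<pi>"
    and "reversible_chain P \<pi>"
  shows "(\<exists>S l. orthogonal_diagonalization P \<pi> S l) \<and>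
    (\<forall>S l. orthogonal_diagonalization P \<pi> S l \<longrightarrow>
      asymptotic_covariance P =
        sqrt_diag \<pi> * transpose_mat S * (1\<^sub>m m + 2 \<cdot>\<^sub>m D_mat m l) * S * sqrt_diag \<pi>) \<and>
    (doubly_stochastic_mat P \<longleftrightarrow> transpose_mat P = P) \<and>
    (doubly_stochastic_mat P \<longrightarrow>
      ((\<exists>a>0. asymptotic_covariance P = a \<cdot>\<^sub>m asymptotic_covariance (uiid_mat m)) \<longleftrightarrow>
       (\<exists>\<alpha>. 0 < \<alpha> \<and> \<alpha> \<le> real m / (real m - 1) \<and>
          P = \<alpha> \<cdot>\<^sub>m uiid_mat m + (1 - \<alpha>) \<cdot>\<^sub>m 1\<^sub>m m)))"
proof -
  obtain k where m: "m = Suc k" and k: "0 < k" using \<open>m \<ge> 2\<close> by (cases m) auto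
  interpret reversible_markov k P \<pi>
    using assms(2-7) by unfold_locales (simp_all add: m)
  \<comment> \<open>Besides proving existence, this fixes the eigenbasis used for the rescaling
    criterion, whose statement does not mention it.\<close>
  obtain S l where od: "orthogonal_diagonalization P \<pi> S l"
    using exists_orthogonal_diagonalization .
  show ?thesis
    unfolding m
  proof (intro conjI allI impI)
    show "\<exists>S l. orthogonal_diagonalization P \<pi> S l" using od by blast
  qed (rule asymptotic_covariance_eq doubly_stochastic_iff_symmetric
      rescaled_iff_lazy_uiid[OF od _ k \<open>aperiodic_chain P\<close>]; assumption)+
qed

end
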